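(* In the setting of the context, let $\hat u\in\mathcal{X}^{\mathfrak s}$ satisfy $\hat G_\gamma(\hat u)\le\hat G_\gamma(u)$ for all $u\in\mathcal{X}^{\mathfrak s}$ (exact discrete solution) and let $\hat u_{\mathcal A}\in\mathcal{X}^{\mathfrak s}$ (a computed solution). Then $$\begin{aligned} \Big(C_a-\frac1{2\gamma}\Big)\|\hat u_{\mathcal A}-u^*\|_V^2\le{}&\sup_{v\in K\cap Y}\inf_{w\in\mathcal{X}^{\mathfrak t}}\big(K_1\|w-v\|_V+K_2\|w-v\|_{L^2(\Omega)}+K_3\|w-v\|_{L^2(\partial\Omega)}\big)\\ &+\inf_{u\in\mathcal{X}^{\mathfrak s}}\big(K_4\|u-u^*\|_V+K_5\|u-u^*\|_{L^2(\Omega)}+K_6\|u-u^*\|_{L^2(\partial\Omega)}\big)\\ &+2\sup_{u\in\mathcal{X}^{\mathfrak s},\,v\in\mathcal{X}^{\mathfrak t}}\big|L_\gamma(u,v)+R_1(u)-R_2(v)-(\hat L_\gamma(u,v)+\hat R_1(u)-\hat R_2(v))\big|\\ &+\hat G_\gamma(\hat u_{\mathcal A})-\hat G_\gamma(\hat u)\\ &+H_\gamma(u^* )-G_\gamma(u^* )+\langle Au^*-f,u^*-\hat u_{\mathcal A}\rangle-R_1(\hat u_{\mathcal A}), \end{aligned}$$ where, with $C_1:=\|Au^*-f\|_{V^*}$, $$K_1=C_bM^{\mathrm s}+\|f\|_{V^*}+\tfrac1\gamma(M^{\mathrm s}+M^{\mathrm t}),\quad K_2=w_{o_2}(r+M^{\mathrm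 t}+2\|\psi\|_{L^2(\Omega)}),\quad K_3=2w_{b_2}(\|h\|_{L^2(\partial\Omega)}+B^{\mathrm t}),$$ $$K_4=C_b(M^{\mathrm s}+M^{\mathrm t})+C_1+\tfrac1\gamma(\|u^*\|_V+M^{\mathrm t}),\quad K_5=w_{o_1}(M^{\mathrm s}+\|u^*\|_V+2\|\psi\|_{L^2(\Omega)}),\quad K_6=2w_{b_1}(\|h\|_{L^2(\partial\Omega)}+B^{\mathrm s}).$$
   Context: $\Omega\subset\mathbb{R}^n$ bounded Lipschitz domain, $V:=H^1(\Omega)$, $\langle\cdot,\cdot\rangle$ the $V^*$–$V$ pairing. Data: $f\in L^2(\Omega)\cap C^0(\Omega)$, $h\in H^{1/2}(\partial\Omega)\cap C^0(\partial\Omega)$, $\psi\in H^1(\Omega)\cap C^0(\Omega)$ with $\psi\le h$ on $\partial\Omega$ (traces), $K:=\{u\in H^1(\Omega):u\ge\psi\text{ in }\Omega,\ u=h\text{ on }\partial\Omega\}$. $A=-\Delta+k\,\mathrm{Id}$, i.e. $\langle Au,w\rangle=\int_\Omega\nabla u\cdot\nabla w+kuw$, $k\ge0$ constant, is assumed to satisfy $\|Au-Av\|_{V^*}\le C_b\|u-v\|_V$ and $\langle Au-Av,u-v\rangle\ge C_a\|u-v\|_V^2$ for all $u,v\in V$ with constants $C_a,C_b>0$. $u^*$ is the unique solution of: $u\in K$, $\langle Au-f,u-v\rangle\le0$ for all $v\in K$. $\gamma>\frac1{2C_a}$. Sets $X,Y$ satisfy: $u^*\in X\cap Y$; $K\cap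 X\subset K\cap Y$; $K\cap Y$ convex and closed in $V$. $r>0$ is a constant with $\|v\|_{L^2(\Omega)}\le r$ for all $v\in K\cap Y$ (e.g. $Y$ the closed ball of radius $r$ about $0$ in $H^2(\Omega)$). Functionals: $L_\gamma(u,v)=\langle Au-f,u-v\rangle-\frac1{2\gamma}\|u-v\|_V^2$; $L_o(u)=\int_\Omega|(\psi-u)^+|^2$; $L_b(u)=\int_{\partial\Omega}|u-h|^2$; $R_i(u)=w_{b_i}L_b(u)+w_{o_i}L_o(u)$, $i=1,2$, with weights $w_{b_i},w_{o_i}\ge0$; $G_\gamma(u)=\sup_{v\in K\cap Y}L_\gamma(u,v)$. Discrete functionals, for fixed points $x_1,\dots,x_N\in\Omega$, $x_1^b,\dots,x_{N_b}^b\in\partial\Omega$ and $u,v\in C^1(\overline\Omega)$: $\hat L(u,v)=\frac{|\Omega|}N\sum_i[\nabla u(x_i)\cdot(\nabla u(x_i)-\nabla v(x_i))+ku(x_i)(u(x_i)-v(x_i))-f(x_i)(u(x_i)-v(x_i))]$; $\hat L_\gamma(u,v)=\hat L(u,v)-\frac{|\Omega|}{2\gamma N}\sum_i[(u(x_i)-v(x_i))^2+|\nabla u(x_i)-\nabla v(x_i)|^2]$; $\hat L_o(u)=\frac{|\Omega|}N\sum_i|(\psi(x_i)-u(x_i))^+|^2$; $\hat L_b(u)=\frac{|\partial\Omega|}{N_b}\sum_i(u(x_i^b)-h(x_i^b))^2$; $\hat R_i(u)=w_{b_i}\hat L_b(u)+w_{o_i}\hat L_o(u)$. $\mathcal{X}^{\mathfrak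 s},\mathcal{X}^{\mathfrak t}\subset C^1(\overline\Omega)$ are non-empty sets (of neural networks, for the solution and the test function) such that, for constants $M^{\mathrm s},B^{\mathrm s},M^{\mathrm t},B^{\mathrm t}>0$: $\|u\|_V\le M^{\mathrm s}$, $\|u\|_{L^2(\partial\Omega)}\le B^{\mathrm s}$ for all $u\in\mathcal{X}^{\mathfrak s}$ and $\|v\|_V\le M^{\mathrm t}$, $\|v\|_{L^2(\partial\Omega)}\le B^{\mathrm t}$ for all $v\in\mathcal{X}^{\mathfrak t}$. Finally $\hat G_\gamma(u)=\sup_{v\in\mathcal{X}^{\mathfrak t}}\hat L_\gamma(u,v)+\hat R_1(u)-\hat R_2(v)$ for $u\in\mathcal{X}^{\mathfrak s}$ and $H_\gamma(u)=\sup_{v\in\mathcal{X}^{\mathfrak t}}L_\gamma(u,v)+R_1(u)-R_2(v)$ for $u\in V$. *)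

theory Defs
  imports "HOL-Analysis.Analysis"
begin

text \<open>
  Elements of $L^2$ and $H^1$ are represented by functions, not by classes modulo a.e. equality.
  Norms below are therefore seminorms on functions, and relations between elements of these
  spaces are stated almost everywhere.
\<close>

section \<open>Square-integrable functions\<close>

definition L2 :: "'a measure \<Rightarrow> ('a \<Rightarrow> real) set" where
  "L2 M = {u \<in> borel_measurable M. integrable M (\<lambda>x. (u x)\<^sup>2)}"

definition L2_norm :: "'a measure \<Rightarrow> ('a \<Rightarrow> real) \<Rightarrow> real" where
  "L2_norm M u = sqrt (\<integral>x. (u x)\<^sup>2 \<partial>M)"


section \<open>The Sobolev space of order one\<close>

primrec cont_diff :: "nat \<Rightarrow> (real^'n \<Rightarrow> real) \<Rightarrow> bool" where
  "cont_diff 0 \<phi> \<longleftrightarrow> continuous_on UNIV \<phi>"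
| "cont_diff (Suc m) \<phi> \<longleftrightarrow> (\<forall>x. \<phi> differentiable (at x)) \<and>
     (\<forall>i. cont_diff m (\<lambda>x. frechet_derivative \<phi> (at x) (axis i 1)))"

definition test_function :: "(real^'n) set \<Rightarrow> (real^'n \<Rightarrow> real) \<Rightarrow> bool" where
  "test_function \<Omega> \<phi> \<longleftrightarrow>
     (\<forall>m. cont_diff m \<phi>) \<and> (\<exists>C. compact C \<and> C \<subseteq> \<Omega> \<and> (\<forall>x. x \<notin> C \<longrightarrow> \<phi> x = 0))"

definition weak_gradient :: "(real^'n) set \<Rightarrow> (real^'n \<Rightarrow> real) \<Rightarrow> (real^'n \<Rightarrow> real^'n) \<Rightarrow> bool" where
  "weak_gradient \<Omega> u g \<longleftrightarrow> (\<forall>i. (\<lambda>x. g x $ i) \<in> L2 (lebesgue_on \<Omega>)) \<and>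
     (\<forall>\<phi> i. test_function \<Omega> \<phi> \<longrightarrow>
        (\<integral>x. u x * frechet_derivative \<phi> (at x) (axis i 1) \<partial>lebesgue_on \<Omega>)
          = - (\<integral>x. g x $ i * \<phi> x \<partial>lebesgue_on \<Omega>))"

definition H1 :: "(real^'n) set \<Rightarrow> (real^'n \<Rightarrow> real) set" where
  "H1 \<Omega> = {u \<in> L2 (lebesgue_on \<Omega>). \<exists>g. weak_gradient \<Omega> u g}"

text \<open>The weak gradient is unique up to null sets, so the choice below is immaterial.\<close>

definition wgrad :: "(real^'n) set \<Rightarrow> (real^'n \<Rightarrow> real) \<Rightarrow> real^'n \<Rightarrow> real^'n" where
  "wgrad \<Omega> u = (SOME g. weak_gradient \<Omega> u g)"

definition H1_norm :: "(real^'n) set \<Rightarrow> (real^'n \<Rightarrow> real) \<Rightarrow> real" where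
  "H1_norm \<Omega> u = sqrt (\<integral>x. (u x)\<^sup>2 + (norm (wgrad \<Omega> u x))\<^sup>2 \<partial>lebesgue_on \<Omega>)"

text \<open>Norm of the dual of $H^1$; the supremum in \<open>real\<close> is meaningful for bounded functionals.\<close>

definition dual_norm :: "(real^'n) set \<Rightarrow> ((real^'n \<Rightarrow> real) \<Rightarrow> real) \<Rightarrow> real" where
  "dual_norm \<Omega> l = (SUP w\<in>{w \<in> H1 \<Omega>. H1_norm \<Omega> w \<le> 1}. \<bar>l w\<bar>)"

definition closed_in_H1 :: "(real^'n) set \<Rightarrow> (real^'n \<Rightarrow> real) set \<Rightarrow> bool" where
  "closed_in_H1 \<Omega> S \<longleftrightarrow> S \<subseteq> H1 \<Omega> \<and>
     (\<forall>s u. (\<forall>n. s n \<in> S) \<and> u \<in> H1 \<Omega> \<and> (\<lambda>n. H1_norm \<Omega> (s n - u)) \<longlonglongrightarrow> 0 \<longrightarrow> u \<in> S)"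

definition convex_functions :: "(real^'n \<Rightarrow> real) set \<Rightarrow> bool" where
  "convex_functions S \<longleftrightarrow>
     (\<forall>u\<in>S. \<forall>v\<in>S. \<forall>t\<in>{0..1}. (\<lambda>x. (1 - t) * u x + t * v x) \<in> S)"


section \<open>Lipschitz domains, surface measure and traces\<close>

text \<open>
  Near each boundary point the domain is the strict epigraph, in some direction \<open>e\<close>, of a
  Lipschitz function of the orthogonal projection onto the hyperplane orthogonal to \<open>e\<close>.
\<close>

definition lipschitz_domain :: "(real^'n) set \<Rightarrow> bool" where
  "lipschitz_domain \<Omega> \<longleftrightarrow> open \<Omega> \<and> connected \<Omega> \<and> \<Omega> \<noteq> {} \<and>
     (\<forall>p\<in>frontier \<Omega>. \<exists>e \<rho> (\<phi> :: real^'n \<Rightarrow> real) L.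
        norm e = 1 \<and> \<rho> > 0 \<and> L-lipschitz_on UNIV \<phi> \<and>
        \<Omega> \<inter> ball p \<rho> = {x \<in> ball p \<rho>. \<phi> (x - (x \<bullet> e) *\<^sub>R e) < x \<bullet> e})"

text \<open>
  Hausdorff outer measure, normalised to agree with Lebesgue measure in integer dimension. Empty
  sets of a cover have weight 0; this only matters for \<open>s = 0\<close>, where one gets counting measure.
  It is a metric outer measure, hence countably additive on Borel sets (Caratheodory), so that
  \<open>measure_of\<close> below yields it and not the zero measure.
\<close>

definition hausdorff_pre :: "nat \<Rightarrow> real \<Rightarrow> (real^'n) set \<Rightarrow> ennreal" where
  "hausdorff_pre s \<delta> A =
     (INF C\<in>{C :: nat \<Rightarrow> (real^'n) set. A \<subseteq> (\<Union>j. C j) \<and> (\<forall>j. bounded (C j) \<and> diameter (C j) \<le> \<delta>)}.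
        \<Sum>j. if C j = {} then 0 else ennreal (unit_ball_vol (real s) * (diameter (C j) / 2) ^ s))"

definition hausdorff :: "nat \<Rightarrow> (real^'n) set \<Rightarrow> ennreal" where
  "hausdorff s A = (SUP \<delta>\<in>{0<..}. hausdorff_pre s \<delta> A)"

definition surface_measure :: "(real^'n) set \<Rightarrow> (real^'n) measure" where
  "surface_measure \<Omega> =
     restrict_space (measure_of UNIV (sets borel) (hausdorff (CARD('n) - 1))) (frontier \<Omega>)"

text \<open>
  $H^{1/2}(\partial\Omega)$ with the Sobolev-Slobodeckij seminorm: the exponent of the kernel is
  $(n-1) + 2\cdot\frac12 = n$. The integrand vanishes on the diagonal.
\<close>

definition H_half :: "(real^'n) set \<Rightarrow> (real^'n \<Rightarrow> real) set" where
  "H_half \<Omega> = {g \<in> L2 (surface_measure \<Omega>).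
     (\<integral>\<^sup>+x. \<integral>\<^sup>+y. ennreal ((g x - g y)\<^sup>2 / dist x y ^ CARD('n))
        \<partial>surface_measure \<Omega> \<partial>surface_measure \<Omega>) < \<infinity>}"

text \<open>
  The trace operator is the bounded linear map from $H^1(\Omega)$ to $L^2(\partial\Omega)$ that
  extends restriction to the boundary. On a bounded Lipschitz domain it exists and is unique up
  to surface null sets.
\<close>

definition trace_operator :: "(real^'n) set \<Rightarrow> ((real^'n \<Rightarrow> real) \<Rightarrow> real^'n \<Rightarrow> real) \<Rightarrow> bool" where
  "trace_operator \<Omega> tr \<longleftrightarrow>
     (\<forall>u\<in>H1 \<Omega>. tr u \<in> L2 (surface_measure \<Omega>)) \<and>
     (\<forall>u\<in>H1 \<Omega>. \<forall>v\<in>H1 \<Omega>. \<forall>a b. AE x in surface_measure \<Omega>.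
        tr (\<lambda>y. a * u y + b * v y) x = a * tr u x + b * tr v x) \<and>
     (\<exists>C. \<forall>u\<in>H1 \<Omega>. L2_norm (surface_measure \<Omega>) (tr u) \<le> C * H1_norm \<Omega> u) \<and>
     (\<forall>u\<in>H1 \<Omega>. continuous_on (closure \<Omega>) u \<longrightarrow>
        (AE x in surface_measure \<Omega>. tr u x = u x))"


section \<open>The obstacle problem\<close>

definition obstacle_set ::
  "(real^'n) set \<Rightarrow> ((real^'n \<Rightarrow> real) \<Rightarrow> real^'n \<Rightarrow> real) \<Rightarrow> (real^'n \<Rightarrow> real) \<Rightarrow> (real^'n \<Rightarrow> real)
     \<Rightarrow> (real^'n \<Rightarrow> real) set" where
  "obstacle_set \<Omega> tr \<psi> h = {u \<in> H1 \<Omega>.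
     (AE x in lebesgue_on \<Omega>. \<psi> x \<le> u x) \<and> (AE x in surface_measure \<Omega>. tr u x = h x)}"

text \<open>\<open>opA \<Omega> k u w\<close> is $\langle Au, w\rangle$ and \<open>src \<Omega> f w\<close> is $\langle f, w\rangle$.\<close>

definition opA :: "(real^'n) set \<Rightarrow> real \<Rightarrow> (real^'n \<Rightarrow> real) \<Rightarrow> (real^'n \<Rightarrow> real) \<Rightarrow> real" where
  "opA \<Omega> k u w = (\<integral>x. wgrad \<Omega> u x \<bullet> wgrad \<Omega> w x + k * u x * w x \<partial>lebesgue_on \<Omega>)"

definition src :: "(real^'n) set \<Rightarrow> (real^'n \<Rightarrow> real) \<Rightarrow> (real^'n \<Rightarrow> real) \<Rightarrow> real" where
  "src \<Omega> f w = (\<integral>x. f x * w x \<partial>lebesgue_on \<Omega>)"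

definition resid ::
  "(real^'n) set \<Rightarrow> real \<Rightarrow> (real^'n \<Rightarrow> real) \<Rightarrow> (real^'n \<Rightarrow> real) \<Rightarrow> (real^'n \<Rightarrow> real) \<Rightarrow> real" where
  "resid \<Omega> k f u w = opA \<Omega> k u w - src \<Omega> f w"

definition solves_VI ::
  "(real^'n) set \<Rightarrow> real \<Rightarrow> (real^'n \<Rightarrow> real) \<Rightarrow> (real^'n \<Rightarrow> real) set \<Rightarrow> (real^'n \<Rightarrow> real) \<Rightarrow> bool" where
  "solves_VI \<Omega> k f K u \<longleftrightarrow> u \<in> K \<and> (\<forall>v\<in>K. resid \<Omega> k f u (u - v) \<le> 0)"


section \<open>Continuous functionals\<close>

definition L_gamma ::
  "(real^'n) set \<Rightarrow> real \<Rightarrow> (real^'n \<Rightarrow> real) \<Rightarrow> real \<Rightarrow> (real^'n \<Rightarrow> real) \<Rightarrow> (real^'n \<Rightarrow> real) \<Rightarrow> real" where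
  "L_gamma \<Omega> k f \<gamma> u v = resid \<Omega> k f u (u - v) - 1 / (2 * \<gamma>) * (H1_norm \<Omega> (u - v))\<^sup>2"

definition L_obst :: "(real^'n) set \<Rightarrow> (real^'n \<Rightarrow> real) \<Rightarrow> (real^'n \<Rightarrow> real) \<Rightarrow> real" where
  "L_obst \<Omega> \<psi> u = (\<integral>x. (max 0 (\<psi> x - u x))\<^sup>2 \<partial>lebesgue_on \<Omega>)"

definition L_bdry ::
  "(real^'n) set \<Rightarrow> ((real^'n \<Rightarrow> real) \<Rightarrow> real^'n \<Rightarrow> real) \<Rightarrow> (real^'n \<Rightarrow> real) \<Rightarrow> (real^'n \<Rightarrow> real) \<Rightarrow> real" where
  "L_bdry \<Omega> tr h u = (\<integral>x. (tr u x - h x)\<^sup>2 \<partial>surface_measure \<Omega>)"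

definition R_pen ::
  "(real^'n) set \<Rightarrow> ((real^'n \<Rightarrow> real) \<Rightarrow> real^'n \<Rightarrow> real) \<Rightarrow> (real^'n \<Rightarrow> real) \<Rightarrow> (real^'n \<Rightarrow> real)
     \<Rightarrow> real \<Rightarrow> real \<Rightarrow> (real^'n \<Rightarrow> real) \<Rightarrow> real" where
  "R_pen \<Omega> tr \<psi> h wb wo u = wb * L_bdry \<Omega> tr h u + wo * L_obst \<Omega> \<psi> u"

definition G_gamma ::
  "(real^'n) set \<Rightarrow> real \<Rightarrow> (real^'n \<Rightarrow> real) \<Rightarrow> real \<Rightarrow> (real^'n \<Rightarrow> real) set \<Rightarrow> (real^'n \<Rightarrow> real) \<Rightarrow> ereal" where
  "G_gamma \<Omega> k f \<gamma> S u = (SUP v\<in>S. ereal (L_gamma \<Omega> k f \<gamma> u v))"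


section \<open>Discrete functionals\<close>

definition C1_closure :: "(real^'n) set \<Rightarrow> (real^'n \<Rightarrow> real) set" where
  "C1_closure \<Omega> = {u. continuous_on (closure \<Omega>) u \<and>
     (\<exists>g. continuous_on (closure \<Omega>) g \<and> (\<forall>x\<in>\<Omega>. GDERIV u x :> g x))}"

definition grad :: "(real^'n \<Rightarrow> real) \<Rightarrow> real^'n \<Rightarrow> real^'n" where
  "grad u x = (THE g. GDERIV u x :> g)"

definition dL ::
  "(real^'n) set \<Rightarrow> real \<Rightarrow> (real^'n \<Rightarrow> real) \<Rightarrow> nat \<Rightarrow> (nat \<Rightarrow> real^'n)
     \<Rightarrow> (real^'n \<Rightarrow> real) \<Rightarrow> (real^'n \<Rightarrow> real) \<Rightarrow> real" where
  "dL \<Omega> k f N x u v = measure lebesgue \<Omega> / real N *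
     (\<Sum>i=1..N. grad u (x i) \<bullet> (grad u (x i) - grad v (x i))
        + k * u (x i) * (u (x i) - v (x i)) - f (x i) * (u (x i) - v (x i)))"

definition dL_gamma ::
  "(real^'n) set \<Rightarrow> real \<Rightarrow> (real^'n \<Rightarrow> real) \<Rightarrow> real \<Rightarrow> nat \<Rightarrow> (nat \<Rightarrow> real^'n)
     \<Rightarrow> (real^'n \<Rightarrow> real) \<Rightarrow> (real^'n \<Rightarrow> real) \<Rightarrow> real" where
  "dL_gamma \<Omega> k f \<gamma> N x u v = dL \<Omega> k f N x u v - measure lebesgue \<Omega> / (2 * \<gamma> * real N) *
     (\<Sum>i=1..N. (u (x i) - v (x i))\<^sup>2 + (norm (grad u (x i) - grad v (x i)))\<^sup>2)"

definition dL_obst ::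
  "(real^'n) set \<Rightarrow> (real^'n \<Rightarrow> real) \<Rightarrow> nat \<Rightarrow> (nat \<Rightarrow> real^'n) \<Rightarrow> (real^'n \<Rightarrow> real) \<Rightarrow> real" where
  "dL_obst \<Omega> \<psi> N x u = measure lebesgue \<Omega> / real N * (\<Sum>i=1..N. (max 0 (\<psi> (x i) - u (x i)))\<^sup>2)"

definition dL_bdry ::
  "(real^'n) set \<Rightarrow> (real^'n \<Rightarrow> real) \<Rightarrow> nat \<Rightarrow> (nat \<Rightarrow> real^'n) \<Rightarrow> (real^'n \<Rightarrow> real) \<Rightarrow> real" where
  "dL_bdry \<Omega> h Nb xb u =
     measure (surface_measure \<Omega>) (frontier \<Omega>) / real Nb * (\<Sum>i=1..Nb. (u (xb i) - h (xb i))\<^sup>2)"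

definition dR_pen ::
  "(real^'n) set \<Rightarrow> (real^'n \<Rightarrow> real) \<Rightarrow> (real^'n \<Rightarrow> real) \<Rightarrow> nat \<Rightarrow> (nat \<Rightarrow> real^'n) \<Rightarrow> nat \<Rightarrow> (nat \<Rightarrow> real^'n)
     \<Rightarrow> real \<Rightarrow> real \<Rightarrow> (real^'n \<Rightarrow> real) \<Rightarrow> real" where
  "dR_pen \<Omega> \<psi> h N x Nb xb wb wo u = wb * dL_bdry \<Omega> h Nb xb u + wo * dL_obst \<Omega> \<psi> N x u"

end

theory Submission
  imports Defs
begin

text \<open>
  Coercivity bounds the error by \<open>L_\<gamma>(u_A, u*)\<close> plus the residual term. The saddle functional with
  the penalties is then compared along the chain of pairs
  \<open>(u_A, u*)\<close>, \<open>(u_A, w)\<close>, discrete \<open>(u_A, w)\<close>, discrete optimum, discrete \<open>(u, v)\<close>,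
  \<open>(u, v)\<close>, \<open>(u*, v)\<close>: replacing the test function costs the terms with \<open>K1\<close>, \<open>K2\<close>, \<open>K3\<close>,
  replacing the solution those with \<open>K4\<close>, \<open>K5\<close>, \<open>K6\<close>, and each passage between continuous and
  discrete functionals one quadrature error. The variational inequality makes \<open>G_\<gamma>(u*)\<close> vanish.

  All norms involve a chosen weak gradient, so linearity of \<open>u \<mapsto> \<nabla>u\<close> almost everywhere rests on the
  fundamental lemma of the calculus of variations; it is obtained from smooth functions
  \<open>exp (- 1 / (m t))\<close>, products of which converge to indicators of boxes.
\<close>

section \<open>Smooth bump functions\<close>

text \<open>A penalty is an integrated square that vanishes on \<open>K\<close>: one factor is
  bounded by a constant, the other by the distance to a member of \<open>K\<close>. This produces
  the linear terms with \<open>K2\<close>, \<open>K3\<close>, \<open>K5\<close> and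
  \<open>K6\<close>. The quadratic term of \<open>L_gamma\<close> is likewise a difference of
  squares, but only one of its two distances is known to be bounded: members of
  \<open>K \<inter> Y\<close> come with an L2 bound, not with an H1 bound. \<open>K1\<close> and
  \<open>K4\<close> rest on \<open>C_b\<close> and dual norms, and a dual norm can be used only once
  its supremum is known to be taken over a bounded set of reals. The coefficient
  \<open>C_a - 1 / (2 * \<gamma>)\<close> is what coercivity leaves after the quadratic term of
  \<open>L_gamma\<close> is paid for. The claim lives in \<open>ereal\<close>, and its differences
  are genuine only because \<open>dG\<close> and \<open>H ustar\<close> are finite; for
  \<open>dG\<close> this cannot come from the H1 bounds on the networks, which do not control values
  and gradients at single points.\<close>

lemma tendsto_poly_mult_exp_minus: "((\<lambda>s. poly p s * exp (- s)) \<longlongrightarrow> (0::real)) at_top"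
proof -
  have "((\<lambda>s. \<Sum>i\<le>degree p. coeff p i * (s ^ i / exp s)) \<longlongrightarrow> (\<Sum>i\<le>degree p. coeff p i * 0)) at_top"
    by (intro tendsto_sum tendsto_mult tendsto_const tendsto_power_div_exp_0)
  moreover have "(\<lambda>s. \<Sum>i\<le>degree p. coeff p i * (s ^ i / exp s)) = (\<lambda>s. poly p s * exp (- s))"
    by (simp add: poly_altdef sum_distrib_right exp_minus divide_inverse mult.assoc)
  ultimately show ?thesis by simp
qed

text \<open>The family is closed under differentiation, which \<open>exp (- 1 / t)\<close> alone is
  not: the polynomial in 1 / t absorbs the factors produced by the chain rule. Iterating
  \<open>flat_deriv\<close> therefore reaches derivatives of every order.\<close>

definition flat :: "real poly \<Rightarrow> real \<Rightarrow> real" where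
  "flat p t = (if t \<le> 0 then 0 else poly p (1 / t) * exp (- 1 / t))"

text \<open>With s = 1 / t, differentiation in t is differentiation in s followed by multiplication
  with -s^2. Applied to p(s) exp(-s) this gives s^2 (p - p')(s) exp(-s), and
  \<open>[:0, 0, 1:]\<close> is s^2.\<close>

definition flat_deriv :: "real poly \<Rightarrow> real poly" where
  "flat_deriv p = [:0, 0, 1:] * (p - pderiv p)"

lemma has_real_derivative_flat: "(flat p has_real_derivative flat (flat_deriv p) t) (at t)"
proof -
  consider "t < 0" | "t = 0" | "t > 0" by linarith
  then show ?thesis
  proof cases
    case 1
    have "((\<lambda>_. 0) has_real_derivative 0) (at t)" by simp
    then have "(flat p has_real_derivative 0) (at t)"
      by (rule has_field_derivative_transform_within_open[of _ _ _ "{..<0}"]) (use 1 in \<open>auto simp: flat_def\<close>)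
    then show ?thesis using 1 by (simp add: flat_def)
  next
    case 2
    \<comment> \<open>Dividing by h multiplies the polynomial by s = 1 / h. The right-hand
      difference quotient at 0 is thus again a polynomial in s times exp(-s), with
      \<open>pCons 0 p\<close> in place of \<open>p\<close>, and s tends to infinity.\<close>
    have "((\<lambda>h. poly (pCons 0 p) (inverse h) * exp (- inverse h)) \<longlongrightarrow> 0) (at_right 0)"
      by (rule filterlim_compose[OF tendsto_poly_mult_exp_minus filterlim_inverse_at_top_right])
    moreover have "\<forall>\<^sub>F h in at_right 0. poly (pCons 0 p) (inverse h) * exp (- inverse h) = flat p h / h"
      by (simp add: eventually_at_filter flat_def divide_inverse mult_ac)
    ultimately have "((\<lambda>h. flat p h / h) \<longlongrightarrow> 0) (at_right 0)"
      by (rule Lim_transform_eventually)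
    moreover have "((\<lambda>h. flat p h / h) \<longlongrightarrow> 0) (at_left 0)"
      by (rule Lim_transform_eventually[OF tendsto_const[of 0]]) (simp add: eventually_at_filter flat_def)
    ultimately have "((\<lambda>h. flat p h / h) \<longlongrightarrow> 0) (at 0)"
      by (simp add: filterlim_split_at)
    then show ?thesis using 2 by (simp add: DERIV_def flat_def)
  next
    case 3
    have inv: "((\<lambda>t. 1 / t) has_real_derivative - (1 / t)\<^sup>2) (at t)"
      using 3 by (auto intro!: derivative_eq_intros simp: power2_eq_square)
    have "((\<lambda>t. poly p (1 / t) * exp (- (1 / t))) has_real_derivative
        poly (pderiv p) (1 / t) * - (1 / t)\<^sup>2 * exp (- (1 / t))
          + exp (- (1 / t)) * - (- (1 / t)\<^sup>2) * poly p (1 / t)) (at t)"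
      by (intro DERIV_mult DERIV_chain2[OF poly_DERIV inv] DERIV_chain2[OF DERIV_exp] DERIV_minus inv)
    moreover have "poly (pderiv p) (1 / t) * - (1 / t)\<^sup>2 * exp (- (1 / t))
          + exp (- (1 / t)) * - (- (1 / t)\<^sup>2) * poly p (1 / t) = flat (flat_deriv p) t"
      using 3 by (simp add: flat_def flat_deriv_def power2_eq_square algebra_simps)
    ultimately have "((\<lambda>t. poly p (1 / t) * exp (- 1 / t)) has_real_derivative flat (flat_deriv p) t) (at t)"
      by simp
    then show ?thesis
      by (rule has_field_derivative_transform_within_open[of _ _ _ "{0<..}"]) (use 3 in \<open>auto simp: flat_def\<close>)
  qed
qed

section \<open>Closure properties of \<open>cont_diff\<close>\<close>

lemma cont_diff_SucD: "cont_diff (Suc m) \<phi> \<Longrightarrow> cont_diff m \<phi>"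
proof (induction m arbitrary: \<phi>)
  case 0
  then show ?case
    by (auto intro!: continuous_at_imp_continuous_on differentiable_imp_continuous_within)
next
  case (Suc m)
  have "cont_diff (Suc m) (\<lambda>x. frechet_derivative \<phi> (at x) (axis i 1))" for i
    using Suc.prems unfolding cont_diff.simps(2)[of "Suc m"] by blast
  then have "cont_diff m (\<lambda>x. frechet_derivative \<phi> (at x) (axis i 1))" for i
    by (rule Suc.IH)
  moreover have "\<forall>x. \<phi> differentiable (at x)"
    using Suc.prems unfolding cont_diff.simps(2)[of "Suc m"] by blast
  ultimately show ?case unfolding cont_diff.simps(2)[of m] by blast
qed

lemma cont_diff_Suc_cases:
  assumes "cont_diff (Suc m) \<phi>"
  shows "(\<phi> has_derivative frechet_derivative \<phi> (at x)) (at x)"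
    and "cont_diff m (\<lambda>x. frechet_derivative \<phi> (at x) (axis i 1))"
  using assms unfolding cont_diff.simps(2) frechet_derivative_works by blast+

lemma cont_diff_SucI:
  assumes "\<And>x. (\<phi> has_derivative \<phi>' x) (at x)" "\<And>i. cont_diff m (\<lambda>x. \<phi>' x (axis i 1))"
  shows "cont_diff (Suc m) \<phi>"
proof -
  have "frechet_derivative \<phi> (at x) = \<phi>' x" for x
    using assms(1) frechet_derivative_at by metis
  then show ?thesis using assms by (auto simp: differentiable_def)
qed

lemma cont_diff_const: "cont_diff m (\<lambda>_. c)"
proof (induction m arbitrary: c)
  case (Suc m)
  show ?case by (rule cont_diff_SucI[of _ "\<lambda>_ _. 0"]) (auto intro: Suc.IH)
qed simp

lemma cont_diff_add: "cont_diff m \<phi> \<Longrightarrow> cont_diff m \<theta> \<Longrightarrow> cont_diff m (\<lambda>x. \<phi> x + \<theta> x)"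
proof (induction m arbitrary: \<phi> \<theta>)
  case 0
  then show ?case by (auto intro: continuous_intros)
next
  case (Suc m)
  show ?case
    by (rule cont_diff_SucI[of _ "\<lambda>x w. frechet_derivative \<phi> (at x) w + frechet_derivative \<theta> (at x) w"])
       (intro has_derivative_add Suc.IH Suc.prems[THEN cont_diff_Suc_cases(1)]
          Suc.prems[THEN cont_diff_Suc_cases(2)])+
qed

text \<open>The product rule leaves one factor undifferentiated in each summand, so the induction
  hypothesis needs that factor at the lower order; \<open>cont_diff_SucD\<close> supplies
  it.\<close>

lemma cont_diff_mult: "cont_diff m \<phi> \<Longrightarrow> cont_diff m \<theta> \<Longrightarrow> cont_diff m (\<lambda>x. \<phi> x * \<theta> x)"
proof (induction m arbitrary: \<phi> \<theta>)
  case 0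
  then show ?case by (auto intro: continuous_intros)
next
  case (Suc m)
  note lower = Suc.prems[THEN cont_diff_SucD]
  show ?case
    by (rule cont_diff_SucI[of _ "\<lambda>x w. \<phi> x * frechet_derivative \<theta> (at x) w + frechet_derivative \<phi> (at x) w * \<theta> x"])
       (intro has_derivative_mult cont_diff_add Suc.IH lower Suc.prems[THEN cont_diff_Suc_cases(1)]
          Suc.prems[THEN cont_diff_Suc_cases(2)])+
qed

lemma cont_diff_prod: "(\<And>i. i \<in> I \<Longrightarrow> cont_diff m (\<phi> i)) \<Longrightarrow> cont_diff m (\<lambda>x. \<Prod>i\<in>I. \<phi> i x)"
  by (induction I rule: infinite_finite_induct) (auto intro: cont_diff_const cont_diff_mult)

text \<open>The sequence \<open>P\<close> of successive derivatives encodes smoothness of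
  \<open>P 0\<close>. Every partial derivative is a constant times the next member of the sequence
  after the same projection, so the induction on \<open>m\<close> runs over all indices
  \<open>n\<close> at once.\<close>

lemma cont_diff_component:
  assumes "\<And>n t. (P n has_real_derivative P (Suc n) t) (at t)"
  shows "cont_diff m (\<lambda>x::real^'n. P n (x $ i))"
proof (induction m arbitrary: n)
  case 0
  have "continuous_on UNIV (P n)"
    by (intro continuous_at_imp_continuous_on ballI DERIV_isCont[OF assms])
  then show ?case
    by (auto intro!: continuous_on_compose2[of UNIV "P n"] continuous_intros)
next
  case (Suc m)
  have "((\<lambda>x. P n (x $ i)) has_derivative (\<lambda>w. w $ i * P (Suc n) (x $ i))) (at x)" for x :: "real^'n"
    by (rule DERIV_compose_FDERIV[OF assms bounded_linear_imp_has_derivative[OF bounded_linear_vec_nth]])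
  moreover have "cont_diff m (\<lambda>x::real^'n. axis j 1 $ i * P (Suc n) (x $ i))" for j
    by (intro cont_diff_mult cont_diff_const Suc.IH)
  ultimately show ?case by (rule cont_diff_SucI)
qed

lemma cont_diff_flat_affine: "cont_diff m (\<lambda>x::real^'n. flat p (c * x $ i + d))"
proof -
  \<comment> \<open>Each differentiation in t brings out one more factor \<open>c\<close> and
    advances the polynomial by \<open>flat_deriv\<close>.\<close>
  define P where "P n t = c ^ n * flat ((flat_deriv ^^ n) p) (c * t + d)" for n t
  have "(P n has_real_derivative P (Suc n) t) (at t)" for n t
  proof -
    have "((\<lambda>t. c * t + d) has_real_derivative c) (at t)"
      by (auto intro!: derivative_eq_intros)
    then have "((\<lambda>t. c ^ n * flat ((flat_deriv ^^ n) p) (c * t + d)) has_real_derivative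
        c ^ n * (flat (flat_deriv ((flat_deriv ^^ n) p)) (c * t + d) * c)) (at t)"
      by (intro DERIV_cmult DERIV_chain2[OF has_real_derivative_flat])
    then show ?thesis
      by (simp add: P_def[abs_def] mult_ac)
  qed
  from cont_diff_component[of P m 0 i, OF this] show ?thesis by (simp add: P_def)
qed

text \<open>\<open>flat 1 (c * t)\<close> is exp(-1 / (c t)) for c t > 0 and 0 otherwise. For
  \<open>c > 0\<close> each pair of factors is positive exactly between two opposite faces of the
  box, and raising \<open>c\<close> lifts the values inside towards 1 without moving the
  support.\<close>

definition box_bump :: "real^'n \<Rightarrow> real^'n \<Rightarrow> real \<Rightarrow> real^'n \<Rightarrow> real" where
  "box_bump a b c x = (\<Prod>i\<in>UNIV. flat 1 (c * (x $ i - a $ i)) * flat 1 (c * (b $ i - x $ i)))"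

lemma flat_one_bounds: "0 \<le> flat 1 t" "flat 1 t \<le> 1"
  by (auto simp: flat_def)

lemma box_bump_eq_0:
  assumes "c > 0" "x \<notin> box a b"
  shows "box_bump a b c x = 0"
proof -
  obtain i where "x $ i \<le> a $ i \<or> b $ i \<le> x $ i"
    using assms(2) by (auto simp: mem_box_cart not_less)
  then have "flat 1 (c * (x $ i - a $ i)) * flat 1 (c * (b $ i - x $ i)) = 0"
    using assms(1) by (auto simp: flat_def mult_le_0_iff zero_less_mult_iff)
  then show ?thesis unfolding box_bump_def by (intro prod_zero) auto
qed

lemma box_bump_bounds: "0 \<le> box_bump a b c x" "box_bump a b c x \<le> 1"
  unfolding box_bump_def
  by (auto intro!: prod_nonneg prod_le_1 mult_nonneg_nonneg mult_le_one flat_one_bounds)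

lemma test_function_box_bump:
  assumes "c > 0" "cbox a b \<subseteq> \<Omega>"
  shows "test_function \<Omega> (box_bump a b c)"
proof -
  have "cont_diff m (\<lambda>x. flat 1 (c * x $ i + (- c * a $ i)) * flat 1 ((- c) * x $ i + c * b $ i))" for m i
    by (intro cont_diff_mult cont_diff_flat_affine)
  then have "cont_diff m (\<lambda>x. flat 1 (c * (x $ i - a $ i)) * flat 1 (c * (b $ i - x $ i)))" for m i
    by (simp add: algebra_simps)
  then have "cont_diff m (box_bump a b c)" for m
    unfolding box_bump_def[abs_def] by (intro cont_diff_prod)
  moreover have "x \<notin> cbox a b \<Longrightarrow> box_bump a b c x = 0" for x
    using box_bump_eq_0[OF assms(1)] box_subset_cbox by blast
  ultimately show ?thesis
    unfolding test_function_def using assms(2) by (intro conjI allI exI[of _ "cbox a b"]) auto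
qed

lemma box_bump_tendsto_indicator:
  "(\<lambda>m. box_bump a b (real (Suc m)) x) \<longlonglongrightarrow> indicator (box a b) x"
proof (cases "x \<in> box a b")
  case True
  have lim: "(\<lambda>m. flat 1 (real (Suc m) * t)) \<longlonglongrightarrow> 1" if "t > 0" for t
  proof -
    have "(\<lambda>m. exp (- (1 / t) * inverse (real (Suc m)))) \<longlonglongrightarrow> exp (- (1 / t) * 0)"
      by (intro tendsto_intros LIMSEQ_inverse_real_of_nat)
    moreover have "exp (- (1 / t) * inverse (real (Suc m))) = flat 1 (real (Suc m) * t)" for m
      using that by (simp add: flat_def mult_le_0_iff not_le field_simps del: of_nat_Suc)
    ultimately show ?thesis by simp
  qed
  have "(\<lambda>m. \<Prod>i\<in>UNIV. flat 1 (real (Suc m) * (x $ i - a $ i)) * flat 1 (real (Suc m) * (b $ i - x $ i)))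
          \<longlonglongrightarrow> (\<Prod>i\<in>(UNIV::'a set). 1 * 1)"
    by (intro tendsto_prod tendsto_mult lim) (use True in \<open>auto simp: mem_box_cart\<close>)
  then show ?thesis using True by (simp add: box_bump_def)
next
  case False
  then show ?thesis by (simp add: box_bump_eq_0)
qed

section \<open>Square-integrable functions\<close>

lemma L2_D: "u \<in> L2 M \<Longrightarrow> u \<in> borel_measurable M" "u \<in> L2 M \<Longrightarrow> integrable M (\<lambda>x. (u x)\<^sup>2)"
  by (auto simp: L2_def)

lemma integrable_mult_L2:
  assumes "u \<in> L2 M" "v \<in> L2 M"
  shows "integrable M (\<lambda>x. u x * v x)"
proof (rule Bochner_Integration.integrable_bound)
  show "integrable M (\<lambda>x. (u x)\<^sup>2 + (v x)\<^sup>2)"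
    using assms by (intro Bochner_Integration.integrable_add L2_D)
  have "\<bar>s * t\<bar> \<le> s\<^sup>2 + t\<^sup>2" for s t :: real
    using sum_squares_bound[of "\<bar>s\<bar>" "\<bar>t\<bar>"] mult_nonneg_nonneg[of "\<bar>s\<bar>" "\<bar>t\<bar>"]
    unfolding abs_mult power2_abs by linarith
  then show "AE x in M. norm (u x * v x) \<le> norm ((u x)\<^sup>2 + (v x)\<^sup>2)" by simp
qed (use assms[THEN L2_D(1)] in measurable)

lemma L2_linear_combination:
  assumes "u \<in> L2 M" "v \<in> L2 M"
  shows "(\<lambda>x. a * u x + b * v x) \<in> L2 M"
proof -
  have "integrable M (\<lambda>x. a\<^sup>2 * (u x)\<^sup>2 + b\<^sup>2 * (v x)\<^sup>2 + 2 * a * b * (u x * v x))"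
    using assms
    by (intro Bochner_Integration.integrable_add Bochner_Integration.integrable_mult_right
        integrable_mult_L2 L2_D)
  moreover have "(a * u x + b * v x)\<^sup>2 = a\<^sup>2 * (u x)\<^sup>2 + b\<^sup>2 * (v x)\<^sup>2 + 2 * a * b * (u x * v x)" for x
    by (simp add: power2_sum power_mult_distrib)
  ultimately show ?thesis
    using assms[THEN L2_D(1)] by (simp add: L2_def)
qed

lemma integrable_L2:
  assumes "finite_measure M" "u \<in> L2 M"
  shows "integrable M u"
proof -
  have "(\<lambda>_. 1) \<in> L2 M"
    using finite_measure.integrable_const[OF assms(1)] by (simp add: L2_def)
  from integrable_mult_L2[OF assms(2) this] show ?thesis by simp
qed

lemma bounded_L2:
  assumes "finite_measure M" "u \<in> borel_measurable M" "\<And>x. x \<in> space M \<Longrightarrow> \<bar>u x\<bar> \<le> B"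
  shows "u \<in> L2 M"
proof -
  have "integrable M (\<lambda>x. (u x)\<^sup>2)"
    using assms
    by (intro finite_measure.integrable_const_bound[where B = "B\<^sup>2"])
       (auto intro!: AE_I2 intro: order_trans[OF _ abs_ge_self] simp: abs_le_square_iff[symmetric])
  then show ?thesis using assms by (simp add: L2_def)
qed

lemma finite_measure_lebesgue_on_bounded_open:
  fixes \<Omega> :: "'a::euclidean_space set"
  assumes "open \<Omega>" "bounded \<Omega>"
  shows "finite_measure (lebesgue_on \<Omega>)"
  using assms finite_measure_lebesgue_on lmeasurable_open by blast


section \<open>The fundamental lemma of the calculus of variations\<close>

text \<open>Boxes form an intersection-stable generator of the Borel sets, so a Dynkin induction
  carries the vanishing of the integrals to all Borel sets. The whole space is not a box;
  \<open>total\<close> is what the complement step uses.\<close>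

lemma AE_eq_0_if_box_integrals_0:
  fixes q :: "'a::euclidean_space \<Rightarrow> real"
  assumes q: "integrable lborel q" and total: "(\<integral>x. q x \<partial>lborel) = 0"
    and boxes: "\<And>a b. (\<integral>x. indicator (box a b) x * q x \<partial>lborel) = 0"
  shows "AE x in lborel. q x = 0"
proof (rule density_unique_real[OF q])
  let ?E = "range (\<lambda>(a, b). box a b :: 'a set)"
  fix A :: "'a set" assume "A \<in> sets lborel"
  then have "A \<in> sigma_sets UNIV ?E"
    by (simp add: borel_eq_box)
  have "Int_stable ?E" "?E \<subseteq> Pow UNIV"
    by (auto simp: Int_stable_def box_Int_box)
  from this \<open>A \<in> sigma_sets UNIV ?E\<close> have "(\<integral>x\<in>A. q x \<partial>lborel) = 0"
  proof (induction rule: sigma_sets_induct_disjoint)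
    case (basic A)
    then show ?case using boxes by (auto simp: set_lebesgue_integral_def)
  next
    case empty
    then show ?case by (simp add: set_lebesgue_integral_def)
  next
    case (compl A)
    have [measurable]: "A \<in> sets borel" using compl by (simp add: borel_eq_box)
    have int_A: "integrable lborel (\<lambda>x. indicator A x *\<^sub>R q x)"
      using q by (intro integrable_mult_indicator) auto
    have "(\<integral>x\<in>(UNIV - A). q x \<partial>lborel) = (\<integral>x. q x - indicator A x *\<^sub>R q x \<partial>lborel)"
      by (auto simp: set_lebesgue_integral_def indicator_def intro!: Bochner_Integration.integral_cong)
    also have "\<dots> = 0"
      using compl total q int_A
      by (subst Bochner_Integration.integral_diff) (auto simp: set_lebesgue_integral_def)
    finally show ?case .
  next
    case (union A)
    have [measurable]: "A i \<in> sets borel" for i using union by (auto simp: borel_eq_box)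
    have "(\<integral>x\<in>(\<Union>i. A i). q x \<partial>lborel) = (\<Sum>i. \<integral>x\<in>A i. q x \<partial>lborel)"
    proof (rule lebesgue_integral_countable_add)
      show "set_integrable lborel (\<Union>i. A i) q"
        unfolding set_integrable_def using q by (intro integrable_mult_indicator) auto
      show "A i \<inter> A j = {}" if "i \<noteq> j" for i j
        using union.hyps that by (auto simp: disjoint_family_on_def)
    qed simp
    then show ?case using union by simp
  qed
  then show "(\<integral>x\<in>A. q x \<partial>lborel) = (\<integral>x\<in>A. 0 \<partial>lborel)" by simp
qed simp

text \<open>Dominated convergence along \<open>box_bump\<close>, whose values in [0, 1] make the
  absolute value of \<open>q\<close> a majorant. The closed box has to lie in
  \<open>\<Omega>\<close> because it is the compact set that carries the bumps.\<close>

lemma integral_box_eq_0: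
  assumes q: "integrable (lebesgue_on \<Omega>) q" and \<Omega>: "open \<Omega>"
    and test: "\<And>\<phi>. test_function \<Omega> \<phi> \<Longrightarrow> (\<integral>x. q x * \<phi> x \<partial>lebesgue_on \<Omega>) = 0"
    and ab: "cbox a b \<subseteq> \<Omega>"
  shows "(\<integral>x. q x * indicator (box a b) x \<partial>lebesgue_on \<Omega>) = 0"
proof -
  have tf: "test_function \<Omega> (box_bump a b (real (Suc m)))" for m
    by (rule test_function_box_bump[OF _ ab]) simp
  have "continuous_on UNIV (box_bump a b (real (Suc m)))" for m
    using tf[of m] cont_diff.simps(1) unfolding test_function_def by blast
  then have meas[measurable]: "box_bump a b (real (Suc m)) \<in> borel_measurable (lebesgue_on \<Omega>)" for m
    using \<Omega> by (intro continuous_imp_measurable_on_sets_lebesgue) (auto intro: continuous_on_subset)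
  have [measurable]: "indicator (box a b) \<in> borel_measurable (lebesgue_on \<Omega>)"
    by (intro borel_measurable_indicator) (use \<Omega> ab box_subset_cbox[of a b] in
        \<open>auto simp: sets_restrict_space image_iff intro!: bexI[of _ "box a b"]\<close>)
  have [measurable]: "q \<in> borel_measurable (lebesgue_on \<Omega>)" using q by simp
  have "(\<lambda>m. \<integral>x. q x * box_bump a b (real (Suc m)) x \<partial>lebesgue_on \<Omega>)
      \<longlonglongrightarrow> (\<integral>x. q x * indicator (box a b) x \<partial>lebesgue_on \<Omega>)"
  proof (rule integral_dominated_convergence)
    show "integrable (lebesgue_on \<Omega>) (\<lambda>x. \<bar>q x\<bar>)" using q by simp
    show "AE x in lebesgue_on \<Omega>. (\<lambda>m. q x * box_bump a b (real (Suc m)) x) \<longlonglongrightarrow> q x * indicator (box a b) x"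
      by (intro AE_I2 tendsto_mult tendsto_const box_bump_tendsto_indicator)
    show "AE x in lebesgue_on \<Omega>. norm (q x * box_bump a b (real (Suc m)) x) \<le> \<bar>q x\<bar>" for m
      using box_bump_bounds[of a b "real (Suc m)"]
      by (intro AE_I2) (auto simp: abs_mult intro!: mult_left_le simp del: of_nat_Suc)
  qed measurable
  then show ?thesis unfolding test[OF tf] by (simp add: LIMSEQ_const_iff)
qed

lemma fundamental_lemma_calculus_of_variations:
  fixes \<Omega> :: "(real^'n) set"
  assumes q: "integrable (lebesgue_on \<Omega>) q" and \<Omega>: "open \<Omega>"
    and test: "\<And>\<phi>. test_function \<Omega> \<phi> \<Longrightarrow> (\<integral>x. q x * \<phi> x \<partial>lebesgue_on \<Omega>) = 0"
  shows "AE x in lebesgue_on \<Omega>. q x = 0"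
proof -
  have \<Omega>_sets: "\<Omega> \<inter> space lebesgue \<in> sets lebesgue" using \<Omega> by simp
  define Q where "Q x = indicator \<Omega> x * q x" for x
  have Q: "integrable lebesgue Q"
    using q integrable_restrict_space[OF \<Omega>_sets, of q] by (simp add: Q_def[abs_def])
  \<comment> \<open>The Dynkin argument lives on Borel sets, whereas \<open>q\<close> is only
    Lebesgue measurable; a Borel function equal almost everywhere replaces its extension by
    zero.\<close>
  then obtain Q' where Q': "Q' \<in> borel_measurable lborel" and QQ': "AE x in lborel. Q x = Q' x"
    using completion_ex_borel_measurable_real by blast
  have QQ'_leb: "AE x in lebesgue. Q x = Q' x"
    using QQ' by (rule AE_completion)
  have "integrable lebesgue Q'"
    using Q QQ'_leb Q' by (metis (mono_tags, lifting) integrable_cong_AE_imp measurable_completion AE_symmetric)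
  then have int_Q': "integrable lborel Q'" using Q' integrable_completion by blast
  have box0: "(\<integral>x. indicator (box a b) x * Q' x \<partial>lborel) = 0" if "cbox a b \<subseteq> \<Omega>" for a b
  proof -
    have "(\<integral>x. indicator (box a b) x * Q' x \<partial>lborel) = (\<integral>x. indicator (box a b) x * Q' x \<partial>lebesgue)"
      using Q' by (intro integral_completion[symmetric]) (auto intro!: borel_measurable_times)
    also have "\<dots> = (\<integral>x. indicator (box a b) x * Q x \<partial>lebesgue)"
    proof (rule integral_cong_AE)
      have Qm: "Q \<in> borel_measurable lebesgue" "Q' \<in> borel_measurable lebesgue"
        using Q measurable_completion[OF Q'] by auto
      have "indicat_real (box a b) \<in> borel_measurable lebesgue"
        by (intro borel_measurable_indicator) simp
      with Qm show "(\<lambda>x. indicator (box a b) x * Q' x) \<in> borel_measurable lebesgue"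
        "(\<lambda>x. indicator (box a b) x * Q x) \<in> borel_measurable lebesgue"
        by (auto intro: borel_measurable_times)
      show "AE x in lebesgue. indicator (box a b) x * Q' x = indicator (box a b) x * Q x"
        using QQ'_leb by eventually_elim simp
    qed
    also have "\<dots> = (\<integral>x. indicator \<Omega> x *\<^sub>R (q x * indicator (box a b) x) \<partial>lebesgue)"
      by (simp add: Q_def mult_ac)
    also have "\<dots> = (\<integral>x. q x * indicator (box a b) x \<partial>lebesgue_on \<Omega>)"
      by (rule integral_restrict_space[OF \<Omega>_sets, symmetric])
    also have "\<dots> = 0" by (rule integral_box_eq_0[OF q \<Omega> test that])
    finally show ?thesis .
  qed
  \<comment> \<open>Countably many closed boxes exhaust \<open>\<Omega>\<close>, so a single one
    suffices. Cutting \<open>Q'\<close> off outside \<open>box a b\<close> makes its integral over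
    every box of the whole space an integral over a box inside \<open>cbox a b\<close>, where test
    functions are available.\<close>
  have local: "AE x in lebesgue. x \<in> cbox a b \<longrightarrow> Q' x = 0" if ab: "cbox a b \<subseteq> \<Omega>" for a b
  proof -
    have "AE x in lborel. indicator (box a b) x * Q' x = 0"
    proof (rule AE_eq_0_if_box_integrals_0)
      show "integrable lborel (\<lambda>x. indicator (box a b) x * Q' x)"
        using integrable_mult_indicator[OF _ int_Q', of "box a b"] by simp
      show "(\<integral>x. indicator (box a b) x * Q' x \<partial>lborel) = 0" by (rule box0[OF ab])
    next
      fix c d :: "real^'n"
      obtain a' b' where ab': "box a b \<inter> box c d = box a' b'"
        unfolding box_Int_box by blast
      show "(\<integral>x. indicator (box c d) x * (indicator (box a b) x * Q' x) \<partial>lborel) = 0"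
      \<comment> \<open>The corners a' and b' are known only through the open box. If that is empty,
        nothing follows for \<open>cbox a' b'\<close>, hence the separate case; otherwise the closed
        box is the closure of the open one.\<close>
      proof (cases "box a' b' = {}")
        case True
        then have "indicator (box c d) x * (indicator (box a b) x * Q' x) = 0" for x
          using ab' by (auto simp: indicator_def)
        then show ?thesis by (simp only: Bochner_Integration.integral_zero)
      next
        case False
        then have "cbox a' b' \<subseteq> cbox a b"
          using ab' by (metis Int_lower1 closure_box closure_mono inf.orderE inf_bot_left)
        then have "(\<integral>x. indicator (box a' b') x * Q' x \<partial>lborel) = 0" using ab by (intro box0) auto
        then show ?thesis
          unfolding ab'[symmetric] by (simp add: indicator_inter_arith mult_ac)
      qed
    qed
    then have "AE x in lebesgue. indicator (box a b) x * Q' x = 0" by (rule AE_completion)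
    \<comment> \<open>The bumps reach only the open box, the cover below uses closed ones; the faces
      form a null set.\<close>
    moreover have "AE x in lebesgue. x \<notin> cbox a b - box a b"
      using negligible_frontier_interval[of a b] 
      unfolding negligible_iff_null_sets by (rule AE_not_in)
    ultimately show ?thesis by eventually_elim (auto simp: indicator_def)
  qed
  obtain \<D> where \<D>: "countable \<D>" "\<D> \<subseteq> Pow \<Omega>" "\<And>X. X \<in> \<D> \<Longrightarrow> \<exists>a b. X = cbox a b" "\<Union>\<D> = \<Omega>"
    using open_countable_Union_open_cbox[OF \<Omega>] by metis
  have "\<forall>X\<in>\<D>. AE x in lebesgue. x \<in> X \<longrightarrow> Q' x = 0"
    using local \<D> by blast
  then have "AE x in lebesgue. \<forall>X\<in>\<D>. x \<in> X \<longrightarrow> Q' x = 0"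
    by (rule AE_ball_countable[THEN iffD2, OF \<D>(1)])
  with QQ'_leb have "AE x in lebesgue. x \<in> \<Omega> \<longrightarrow> q x = 0"
  proof eventually_elim
    case (elim x)
    then show ?case using \<D>(4) by (auto simp: Q_def indicator_def)
  qed
  then show ?thesis using AE_restrict_space_iff[OF \<Omega>_sets] by blast
qed

section \<open>Weak gradients\<close>

abbreviation pderivative :: "'n \<Rightarrow> (real^'n \<Rightarrow> real) \<Rightarrow> real^'n \<Rightarrow> real" where
  "pderivative i \<phi> x \<equiv> frechet_derivative \<phi> (at x) (axis i 1)"

lemma test_function_has_derivative:
  "test_function \<Omega> \<phi> \<Longrightarrow> (\<phi> has_derivative frechet_derivative \<phi> (at x)) (at x)"
  unfolding test_function_def using cont_diff_Suc_cases(1) by blast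

lemma test_function_continuous:
  assumes "test_function \<Omega> \<phi>"
  shows "continuous_on UNIV \<phi>" "continuous_on UNIV (pderivative i \<phi>)"
proof -
  have "cont_diff 0 \<phi>" "cont_diff (Suc 0) \<phi>"
    using assms unfolding test_function_def by blast+
  then show "continuous_on UNIV \<phi>" "continuous_on UNIV (pderivative i \<phi>)"
    using cont_diff_Suc_cases(2)[of 0 \<phi> i] by (simp_all add: cont_diff.simps(1))
qed

text \<open>The complement of the compact set is open and the function is locally zero there, so its
  derivatives vanish too: one set serves for the function and all its partial derivatives.\<close>

lemma test_function_support:
  assumes "test_function \<Omega> \<phi>"
  obtains C where "compact C" "C \<subseteq> \<Omega>" "\<And>x. x \<notin> C \<Longrightarrow> \<phi> x = 0"
    "\<And>x i. x \<notin> C \<Longrightarrow> pderivative i \<phi> x = 0"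
proof -
  obtain C where C: "compact C" "C \<subseteq> \<Omega>" "\<And>x. x \<notin> C \<Longrightarrow> \<phi> x = 0"
    using assms unfolding test_function_def by metis
  have "pderivative i \<phi> x = 0" if "x \<notin> C" for x i
  proof -
    have "(\<phi> has_derivative (\<lambda>_. 0)) (at x)"
      by (rule has_derivative_transform_within_open[of "\<lambda>_. 0" _ _ _ "- C"])
         (use C that in \<open>auto simp: compact_imp_closed open_Compl\<close>)
    then show ?thesis by (metis frechet_derivative_at)
  qed
  with C that show ?thesis by blast
qed

lemma compact_support_bounded:
  fixes \<phi> :: "'a::topological_space \<Rightarrow> real"
  assumes "continuous_on UNIV \<phi>" "compact C" "\<And>x. x \<notin> C \<Longrightarrow> \<phi> x = 0"
  obtains B where "\<And>x. \<bar>\<phi> x\<bar> \<le> B"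
proof -
  have "bounded (\<phi> ` C)"
    using assms by (intro compact_imp_bounded compact_continuous_image) (auto intro: continuous_on_subset)
  then obtain B where B: "\<And>x. x \<in> C \<Longrightarrow> \<bar>\<phi> x\<bar> \<le> B"
    unfolding bounded_iff by auto
  have "\<bar>\<phi> x\<bar> \<le> \<bar>B\<bar>" for x
    using B[of x] assms(3)[of x] by (cases "x \<in> C") auto
  then show ?thesis by (rule that)
qed

lemma test_function_L2:
  assumes "open \<Omega>" "bounded \<Omega>" "test_function \<Omega> \<phi>"
  shows "\<phi> \<in> L2 (lebesgue_on \<Omega>)" "pderivative i \<phi> \<in> L2 (lebesgue_on \<Omega>)"
proof -
  note fin = finite_measure_lebesgue_on_bounded_open[OF assms(1,2)]
  note cont = test_function_continuous[OF assms(3)]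
  obtain C where C: "compact C" "\<And>x. x \<notin> C \<Longrightarrow> \<phi> x = 0" "\<And>x i. x \<notin> C \<Longrightarrow> pderivative i \<phi> x = 0"
    using test_function_support[OF assms(3)] by metis
  have "\<theta> \<in> L2 (lebesgue_on \<Omega>)" if \<theta>: "continuous_on UNIV \<theta>" "\<And>x. x \<notin> C \<Longrightarrow> \<theta> x = 0" for \<theta>
  proof -
    obtain B where "\<And>x. \<bar>\<theta> x\<bar> \<le> B"
      using compact_support_bounded[OF \<theta>(1) C(1) \<theta>(2)] by blast
    then show ?thesis
      using \<theta> assms(1)
      by (intro bounded_L2[OF fin] continuous_imp_measurable_on_sets_lebesgue)
         (auto intro: continuous_on_subset)
  qed
  then show "\<phi> \<in> L2 (lebesgue_on \<Omega>)" "pderivative i \<phi> \<in> L2 (lebesgue_on \<Omega>)"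
    using cont C by blast+
qed

lemma weak_gradient_L2: "weak_gradient \<Omega> u g \<Longrightarrow> (\<lambda>x. g x $ i) \<in> L2 (lebesgue_on \<Omega>)"
  by (simp add: weak_gradient_def)

lemma weak_gradient_linear_combination:
  assumes \<Omega>: "open \<Omega>" "bounded \<Omega>"
    and u: "u \<in> L2 (lebesgue_on \<Omega>)" "weak_gradient \<Omega> u g"
    and v: "v \<in> L2 (lebesgue_on \<Omega>)" "weak_gradient \<Omega> v g'"
  shows "weak_gradient \<Omega> (\<lambda>x. a * u x + b * v x) (\<lambda>x. a *\<^sub>R g x + b *\<^sub>R g' x)"
  unfolding weak_gradient_def
proof (intro conjI allI impI)
  let ?M = "lebesgue_on \<Omega>"
  fix i
  note gi = weak_gradient_L2[OF u(2), of i] weak_gradient_L2[OF v(2), of i]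
  then show "(\<lambda>x. (a *\<^sub>R g x + b *\<^sub>R g' x) $ i) \<in> L2 ?M"
    by (simp add: L2_linear_combination)
  fix \<phi> :: "real^'a \<Rightarrow> real" assume \<phi>: "test_function \<Omega> \<phi>"
  note \<phi>2 = test_function_L2[OF \<Omega> \<phi>]
  have lin: "(\<integral>x. (a * s x + b * t x) * \<theta> x \<partial>?M) = a * (\<integral>x. s x * \<theta> x \<partial>?M) + b * (\<integral>x. t x * \<theta> x \<partial>?M)"
    if "s \<in> L2 ?M" "t \<in> L2 ?M" "\<theta> \<in> L2 ?M" for s t \<theta>
  proof -
    have "(\<integral>x. (a * s x + b * t x) * \<theta> x \<partial>?M) = (\<integral>x. a * (s x * \<theta> x) + b * (t x * \<theta> x) \<partial>?M)"
      by (simp add: algebra_simps)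
    also have "\<dots> = a * (\<integral>x. s x * \<theta> x \<partial>?M) + b * (\<integral>x. t x * \<theta> x \<partial>?M)"
      using integrable_mult_L2[OF that(1,3)] integrable_mult_L2[OF that(2,3)] by simp
    finally show ?thesis .
  qed
  have "(\<integral>x. u x * pderivative i \<phi> x \<partial>?M) = - (\<integral>x. g x $ i * \<phi> x \<partial>?M)"
    "(\<integral>x. v x * pderivative i \<phi> x \<partial>?M) = - (\<integral>x. g' x $ i * \<phi> x \<partial>?M)"
    using u(2) v(2) \<phi> unfolding weak_gradient_def by blast+
  then show "(\<integral>x. (a * u x + b * v x) * pderivative i \<phi> x \<partial>?M)
      = - (\<integral>x. (a *\<^sub>R g x + b *\<^sub>R g' x) $ i * \<phi> x \<partial>?M)"
    using lin[OF u(1) v(1) \<phi>2(2)[of i]] lin[OF gi \<phi>2(1)] by simp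
qed

text \<open>Both gradients have the same integrals against test functions, so the fundamental lemma
  applies to each component of the difference. L2 functions on a bounded set are integrable, as that
  lemma requires.\<close>

lemma weak_gradient_unique:
  assumes \<Omega>: "open \<Omega>" "bounded \<Omega>"
    and g: "weak_gradient \<Omega> u g" "weak_gradient \<Omega> u g'"
  shows "AE x in lebesgue_on \<Omega>. g x = g' x"
proof -
  let ?M = "lebesgue_on \<Omega>"
  note fin = finite_measure_lebesgue_on_bounded_open[OF \<Omega>]
  have "AE x in ?M. g x $ i = g' x $ i" for i
  proof -
    let ?q = "\<lambda>x. g x $ i - g' x $ i"
    note gi = g[THEN weak_gradient_L2, of i]
    have "AE x in ?M. ?q x = 0"
    proof (rule fundamental_lemma_calculus_of_variations[OF _ \<Omega>(1)])
      show "integrable ?M ?q"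
        using gi by (intro Bochner_Integration.integrable_diff integrable_L2[OF fin])
      fix \<phi> :: "real^'a \<Rightarrow> real" assume \<phi>: "test_function \<Omega> \<phi>"
      note \<phi>2 = test_function_L2(1)[OF \<Omega> \<phi>]
      have "(\<integral>x. g x $ i * \<phi> x \<partial>?M) = (\<integral>x. g' x $ i * \<phi> x \<partial>?M)"
        using g[unfolded weak_gradient_def, THEN conjunct2, rule_format, OF \<phi>, of i] by simp
      then show "(\<integral>x. ?q x * \<phi> x \<partial>?M) = 0"
        using integrable_mult_L2[OF gi(1) \<phi>2] integrable_mult_L2[OF gi(2) \<phi>2]
        by (simp add: left_diff_distrib)
    qed
    then show ?thesis by simp
  qed
  then have "AE x in ?M. \<forall>i\<in>UNIV. g x $ i = g' x $ i"
    by (intro AE_finite_allI) auto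
  then show ?thesis by (simp add: vec_eq_iff)
qed

lemma H1_D:
  assumes "u \<in> H1 \<Omega>"
  shows "u \<in> L2 (lebesgue_on \<Omega>)" "weak_gradient \<Omega> u (wgrad \<Omega> u)"
    "(\<lambda>x. wgrad \<Omega> u x $ i) \<in> L2 (lebesgue_on \<Omega>)"
proof -
  show "u \<in> L2 (lebesgue_on \<Omega>)" using assms by (simp add: H1_def)
  show g: "weak_gradient \<Omega> u (wgrad \<Omega> u)"
    using assms unfolding wgrad_def H1_def by (auto intro: someI_ex[of "weak_gradient \<Omega> u"])
  show "(\<lambda>x. wgrad \<Omega> u x $ i) \<in> L2 (lebesgue_on \<Omega>)" by (rule weak_gradient_L2[OF g])
qed

lemma H1_linear_combination:
  assumes \<Omega>: "open \<Omega>" "bounded \<Omega>" and u: "u \<in> H1 \<Omega>" and v: "v \<in> H1 \<Omega>"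
  shows "(\<lambda>x. a * u x + b * v x) \<in> H1 \<Omega>"
    and "AE x in lebesgue_on \<Omega>. wgrad \<Omega> (\<lambda>x. a * u x + b * v x) x = a *\<^sub>R wgrad \<Omega> u x + b *\<^sub>R wgrad \<Omega> v x"
proof -
  note wg = weak_gradient_linear_combination[OF \<Omega> H1_D(1,2)[OF u] H1_D(1,2)[OF v], of a b]
  show "(\<lambda>x. a * u x + b * v x) \<in> H1 \<Omega>"
    using wg L2_linear_combination[OF H1_D(1)[OF u] H1_D(1)[OF v]] by (auto simp: H1_def)
  then show "AE x in lebesgue_on \<Omega>. wgrad \<Omega> (\<lambda>x. a * u x + b * v x) x = a *\<^sub>R wgrad \<Omega> u x + b *\<^sub>R wgrad \<Omega> v x"
    by (rule weak_gradient_unique[OF \<Omega> H1_D(2) wg])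
qed


section \<open>Continuously differentiable functions are in the Sobolev space\<close>

text \<open>Translation invariance kills the integral of every difference quotient.\<close>

lemma integral_directional_derivative_eq_0:
  fixes F :: "'a::euclidean_space \<Rightarrow> real"
  assumes contF: "continuous_on UNIV F"
    and deriv: "\<And>y t. ((\<lambda>t. F (y + t *\<^sub>R e)) has_real_derivative D (y + t *\<^sub>R e)) (at t)"
    and bound: "\<And>y. \<bar>D y\<bar> \<le> B"
    and supp: "bounded S" "\<And>y. y \<notin> S \<Longrightarrow> F y = 0"
  shows "(\<integral>y. D y \<partial>lebesgue) = 0"
proof -
  define h where "h m = inverse (real (Suc m))" for m
  have h: "h m > 0" "h m \<le> 1" for m by (auto simp: h_def field_simps)
  have h0: "h \<longlonglongrightarrow> 0" unfolding h_def[abs_def] by (rule LIMSEQ_inverse_real_of_nat)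
  define q where "q m y = (F (y + h m *\<^sub>R e) - F y) / h m" for m y
  obtain r where r: "\<And>y. y \<in> S \<Longrightarrow> norm y \<le> r"
    using supp(1) unfolding bounded_iff by blast
  \<comment> \<open>Since \<open>h m \<le> 1\<close>, this ball contains all points at which
    \<open>F\<close> or one of its shifts is nonzero.\<close>
  let ?T = "cball 0 (r + norm e) :: 'a set"
  have F0: "F y = 0" if "y \<notin> ?T" for y
    using that r[of y] supp(2)[of y] norm_ge_zero[of e] by (cases "y \<in> S") auto
  have Fh0: "F (y + h m *\<^sub>R e) = 0" if "y \<notin> ?T" for y m
  proof (rule supp(2), rule notI)
    assume "y + h m *\<^sub>R e \<in> S"
    then have "norm (y + h m *\<^sub>R e) \<le> r" by (rule r)
    moreover have "norm y \<le> norm (y + h m *\<^sub>R e) + norm (h m *\<^sub>R e)"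
      using norm_triangle_ineq4[of "y + h m *\<^sub>R e" "h m *\<^sub>R e"] by simp
    moreover have "norm (h m *\<^sub>R e) \<le> norm e"
      using h[of m] by (simp add: mult_left_le_one_le)
    ultimately show False using that by simp
  qed
  have [measurable]: "F \<in> borel_measurable borel"
    using contF by (rule borel_measurable_continuous_onI)
  have q_meas: "q m \<in> borel_measurable lborel" for m
    unfolding q_def[abs_def] by measurable
  have lim: "(\<lambda>m. q m y) \<longlonglongrightarrow> D y" for y
  proof -
    have "((\<lambda>t. (F (y + t *\<^sub>R e) - F y) / t) \<longlongrightarrow> D y) (at 0)"
      using deriv[of y 0] by (simp add: DERIV_def)
    moreover have "filterlim h (at 0) sequentially"
      using h0 h(1) by (auto simp: filterlim_at intro!: always_eventually less_imp_neq[symmetric])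
    ultimately show ?thesis
      unfolding q_def by (rule filterlim_compose)
  qed
  \<comment> \<open>The mean value theorem turns the bound on the derivative into one on all
    quotients; together with the common ball this is an integrable majorant.\<close>
  have q_bound: "\<bar>q m y\<bar> \<le> B * indicator ?T y" for m y
  proof (cases "y \<in> ?T")
    case True
    obtain z where "F (y + h m *\<^sub>R e) - F (y + 0 *\<^sub>R e) = (h m - 0) * D (y + z *\<^sub>R e)"
      using MVT2[of 0 "h m" "\<lambda>t. F (y + t *\<^sub>R e)" "\<lambda>t. D (y + t *\<^sub>R e)"] h(1) deriv by auto
    then show ?thesis using True h(1)[of m] bound by (simp add: q_def)
  qed (simp add: q_def F0 Fh0)
  have int_F: "integrable lborel F"
  proof -
    have "integrable lborel (\<lambda>y. indicator ?T y *\<^sub>R F y)"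
      using contF by (intro borel_integrable_compact) (auto intro: continuous_on_subset)
    moreover have "(\<lambda>y. indicator ?T y *\<^sub>R F y) = F"
      using F0 by (auto simp: indicator_def fun_eq_iff)
    ultimately show ?thesis by simp
  qed
  have int_T: "integrable lborel (\<lambda>y. B * indicator ?T y)"
    by (intro integrable_mult_right integrable_real_indicator) (use emeasure_bounded_finite[OF bounded_cball, of "0::'a" "r + norm e"] in auto)
  have "(\<integral>y. q m y \<partial>lborel) = 0" for m
  proof -
    have shift: "distr lborel borel ((+) (h m *\<^sub>R e)) = lborel" by (rule lborel_distr_plus)
    have "integrable lborel (\<lambda>y. F (h m *\<^sub>R e + y))"
      using integrable_distr_eq[of "(+) (h m *\<^sub>R e)" lborel borel F] int_F shift by simp
    moreover have "(\<integral>y. F (h m *\<^sub>R e + y) \<partial>lborel) = (\<integral>y. F y \<partial>lborel)"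
      using integral_distr[of "(+) (h m *\<^sub>R e)" lborel borel F] shift by simp
    ultimately show ?thesis
      using int_F unfolding q_def by (simp add: add.commute)
  qed
  moreover have D_meas: "D \<in> borel_measurable lborel"
    by (rule borel_measurable_LIMSEQ_real[OF lim q_meas])
  moreover have "(\<lambda>m. \<integral>y. q m y \<partial>lborel) \<longlonglongrightarrow> (\<integral>y. D y \<partial>lborel)"
    by (rule integral_dominated_convergence[OF D_meas q_meas int_T]) (use lim q_bound in auto)
  ultimately show ?thesis by (simp add: LIMSEQ_const_iff integral_completion)
qed

text \<open>Integration by parts: the partial derivatives of u times a test function, extended by
  zero, have integral zero over the whole space. The compact support inside \<open>\<Omega>\<close>
  removes every boundary term.\<close>

lemma classical_gradient_is_weak_gradient:
  fixes \<Omega> :: "(real^'n) set"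
  assumes \<Omega>: "open \<Omega>" "bounded \<Omega>"
    and u: "continuous_on (closure \<Omega>) u" and g: "continuous_on (closure \<Omega>) g"
    and deriv: "\<And>x. x \<in> \<Omega> \<Longrightarrow> GDERIV u x :> g x"
  shows "u \<in> L2 (lebesgue_on \<Omega>)" "weak_gradient \<Omega> u g"
proof -
  let ?M = "lebesgue_on \<Omega>"
  note fin = finite_measure_lebesgue_on_bounded_open[OF \<Omega>]
  have bounded_closure: "\<exists>B. \<forall>x\<in>\<Omega>. \<bar>w x\<bar> \<le> B" if "continuous_on (closure \<Omega>) w" for w :: "real^'n \<Rightarrow> real"
  proof -
    have "bounded (w ` closure \<Omega>)"
      using that \<Omega> by (intro compact_imp_bounded compact_continuous_image) (auto simp: compact_closure)
    then show ?thesis unfolding bounded_iff using closure_subset by fastforce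
  qed
  have L2_closure: "w \<in> L2 ?M" if w: "continuous_on (closure \<Omega>) w" for w :: "real^'n \<Rightarrow> real"
  proof -
    obtain B where "\<forall>x\<in>\<Omega>. \<bar>w x\<bar> \<le> B" using bounded_closure[OF w] by blast
    then show ?thesis
      using w \<Omega> closure_subset
      by (intro bounded_L2[OF fin] continuous_imp_measurable_on_sets_lebesgue)
         (auto intro: continuous_on_subset)
  qed
  have gi_cont: "continuous_on (closure \<Omega>) (\<lambda>x. g x $ i)" for i
    using g by (intro continuous_intros)
  show u_L2: "u \<in> L2 ?M" by (rule L2_closure[OF u])
  show "weak_gradient \<Omega> u g"
    unfolding weak_gradient_def
  proof (intro conjI allI impI)
    fix i
    show gi_L2: "(\<lambda>x. g x $ i) \<in> L2 ?M" by (rule L2_closure[OF gi_cont])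
    fix \<phi> :: "real^'n \<Rightarrow> real" assume \<phi>: "test_function \<Omega> \<phi>"
    note \<phi>2 = test_function_L2[OF \<Omega> \<phi>]
    obtain C where C: "compact C" "C \<subseteq> \<Omega>" "\<And>x. x \<notin> C \<Longrightarrow> \<phi> x = 0"
        "\<And>x i. x \<notin> C \<Longrightarrow> pderivative i \<phi> x = 0"
      using test_function_support[OF \<phi>] by metis
    \<comment> \<open>The extension by zero is differentiable everywhere: on \<open>\<Omega>\<close>
      by the product rule, and at any other point because it lies in the open complement of
      \<open>C\<close>, where \<open>F\<close> vanishes.\<close>
    define F where "F y = (if y \<in> \<Omega> then u y * \<phi> y else 0)" for y
    define F' where "F' y w = (if y \<in> \<Omega>
        then u y * frechet_derivative \<phi> (at y) w + (g y \<bullet> w) * \<phi> y else 0)" for y w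
    define D where "D y = F' y (axis i 1)" for y
    have F': "(F has_derivative F' y) (at y)" for y
    proof (cases "y \<in> \<Omega>")
      case True
      have "((\<lambda>y. u y * \<phi> y) has_derivative F' y) (at y)"
        using has_derivative_mult[OF deriv[OF True, unfolded gderiv_def] test_function_has_derivative[OF \<phi>]] True
        by (simp add: F'_def[abs_def] inner_commute)
      then show ?thesis
        by (rule has_derivative_transform_within_open[OF _ \<Omega>(1) True]) (simp add: F_def)
    next
      case False
      then have "((\<lambda>_. 0) has_derivative F' y) (at y)"
        by (simp add: F'_def[abs_def])
      then show ?thesis
        by (rule has_derivative_transform_within_open[of _ _ _ _ "- C"])
           (use C False in \<open>auto simp: F_def compact_imp_closed open_Compl\<close>)
    qed
    have "(\<integral>y. D y \<partial>lebesgue) = 0"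
    proof -
      obtain Bu where Bu: "\<And>x. x \<in> \<Omega> \<Longrightarrow> \<bar>u x\<bar> \<le> Bu" using bounded_closure[OF u] by blast
      obtain Bg where Bg: "\<And>x. x \<in> \<Omega> \<Longrightarrow> \<bar>g x $ i\<bar> \<le> Bg" using bounded_closure[OF gi_cont] by blast
      obtain B0 where B0: "\<And>x. \<bar>\<phi> x\<bar> \<le> B0"
        using compact_support_bounded[OF test_function_continuous(1)[OF \<phi>] C(1,3)] by blast
      obtain B1 where B1: "\<And>x. \<bar>pderivative i \<phi> x\<bar> \<le> B1"
        using compact_support_bounded[OF test_function_continuous(2)[OF \<phi>] C(1,4)] by blast
      show ?thesis
      proof (rule integral_directional_derivative_eq_0[where F = F and e = "axis i 1" and S = \<Omega>])
        show "continuous_on UNIV F"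
          using F' has_derivative_continuous by (blast intro: continuous_at_imp_continuous_on)
        show "((\<lambda>t. F (y + t *\<^sub>R axis i 1)) has_real_derivative D (y + t *\<^sub>R axis i 1)) (at t)" for y t
        proof -
          have "((\<lambda>t. y + t *\<^sub>R axis i 1) has_derivative (\<lambda>s. s *\<^sub>R axis i 1)) (at t)"
            by (auto intro!: derivative_eq_intros)
          from has_derivative_compose[OF this F'] show ?thesis
            unfolding has_field_derivative_def D_def
            by (simp add: linear_cmul[OF has_derivative_linear[OF F']] mult_commute_abs)
        qed
        show "\<bar>D y\<bar> \<le> \<bar>Bu * B1\<bar> + \<bar>Bg * B0\<bar>" for y
        proof (cases "y \<in> \<Omega>")
          case True
          have "\<bar>u y * pderivative i \<phi> y\<bar> \<le> Bu * B1" "\<bar>g y $ i * \<phi> y\<bar> \<le> Bg * B0"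
            using Bu[OF True] Bg[OF True] B0[of y] B1[of y] unfolding abs_mult
            by (auto intro!: mult_mono)
          moreover have "D y = u y * pderivative i \<phi> y + g y $ i * \<phi> y"
            using True by (simp add: D_def F'_def inner_axis)
          ultimately show ?thesis by linarith
        qed (simp add: D_def F'_def)
      qed (use \<Omega>(2) in \<open>auto simp: F_def\<close>)
    qed
    also have "(\<integral>y. D y \<partial>lebesgue)
        = (\<integral>y. indicator \<Omega> y *\<^sub>R (u y * pderivative i \<phi> y + g y $ i * \<phi> y) \<partial>lebesgue)"
      by (intro Bochner_Integration.integral_cong) (auto simp: D_def F'_def inner_axis)
    also have "\<dots> = (\<integral>y. u y * pderivative i \<phi> y + g y $ i * \<phi> y \<partial>?M)"
      using \<Omega> by (intro integral_restrict_space[symmetric]) simp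
    also have "\<dots> = (\<integral>y. u y * pderivative i \<phi> y \<partial>?M) + (\<integral>y. g y $ i * \<phi> y \<partial>?M)"
      by (intro Bochner_Integration.integral_add integrable_mult_L2 u_L2 gi_L2 \<phi>2)
    finally show "(\<integral>x. u x * pderivative i \<phi> x \<partial>?M) = - (\<integral>x. g x $ i * \<phi> x \<partial>?M)"
      by linarith
  qed
qed

lemma C1_closure_subset_H1:
  assumes "open \<Omega>" "bounded \<Omega>"
  shows "C1_closure \<Omega> \<subseteq> H1 \<Omega>"
  using classical_gradient_is_weak_gradient[OF assms] unfolding C1_closure_def H1_def by blast

section \<open>Positive semidefinite forms\<close>

locale semi_inner =
  fixes V :: "('a \<Rightarrow> real) set" and B :: "('a \<Rightarrow> real) \<Rightarrow> ('a \<Rightarrow> real) \<Rightarrow> real"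
  assumes mem_combination: "u \<in> V \<Longrightarrow> v \<in> V \<Longrightarrow> (\<lambda>x. a * u x + b * v x) \<in> V"
    and sym: "u \<in> V \<Longrightarrow> v \<in> V \<Longrightarrow> B u v = B v u"
    and combination_left: "u \<in> V \<Longrightarrow> v \<in> V \<Longrightarrow> w \<in> V \<Longrightarrow>
          B (\<lambda>x. a * u x + b * v x) w = a * B u w + b * B v w"
    and nonneg: "u \<in> V \<Longrightarrow> B u u \<ge> 0"
begin

lemma diff_mem: "u \<in> V \<Longrightarrow> v \<in> V \<Longrightarrow> u - v \<in> V"
  using mem_combination[of u v 1 "- 1"] by (simp add: fun_diff_def)

lemma zero_mem: "u \<in> V \<Longrightarrow> (\<lambda>_. 0) \<in> V"
  using mem_combination[of u u 0 0] by simp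

lemma diff_left: "u \<in> V \<Longrightarrow> v \<in> V \<Longrightarrow> w \<in> V \<Longrightarrow> B (u - v) w = B u w - B v w"
  using combination_left[of u v w 1 "- 1"] by (simp add: fun_diff_def)

lemma diff_right: "u \<in> V \<Longrightarrow> v \<in> V \<Longrightarrow> w \<in> V \<Longrightarrow> B w (u - v) = B w u - B w v"
  using diff_left[of u v w] by (simp add: sym diff_mem)

lemma scale_right: "u \<in> V \<Longrightarrow> w \<in> V \<Longrightarrow> B w (\<lambda>x. c * u x) = c * B w u"
  using combination_left[of u u w c 0] mem_combination[of u u c 0] sym[of w u] sym[of w "\<lambda>x. c * u x"] by simp

lemma zero_left: "w \<in> V \<Longrightarrow> B (\<lambda>_. 0) w = 0"
  using combination_left[of w w w 0 0] by simp

lemma square_diff: "u \<in> V \<Longrightarrow> v \<in> V \<Longrightarrow> B (u - v) (u - v) = B u u - 2 * B u v + B v v"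
  by (simp add: diff_left diff_right diff_mem sym)

lemma Cauchy_Schwarz_square:
  assumes "u \<in> V" "v \<in> V"
  shows "(B u v)\<^sup>2 \<le> B u u * B v v"
proof -
  have quad: "0 \<le> a\<^sup>2 * B u u + 2 * a * b * B u v + b\<^sup>2 * B v v" for a b
  proof -
    let ?w = "\<lambda>x. a * u x + b * v x"
    have w: "?w \<in> V" using assms by (rule mem_combination)
    have "B ?w ?w = a * B ?w u + b * B ?w v"
      using combination_left[OF assms w] by (simp add: sym[OF w] assms)
    also have "\<dots> = a\<^sup>2 * B u u + 2 * a * b * B u v + b\<^sup>2 * B v v"
      using assms by (simp add: combination_left sym[of v u] power2_eq_square algebra_simps)
    finally show ?thesis using nonneg[OF w] by simp
  qed
  show ?thesis
  proof (cases "B v v = 0")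
    case True
    have "B u v = 0"
    proof (rule ccontr)
      assume "B u v \<noteq> 0"
      \<comment> \<open>For B v v = 0 the quadratic form is affine in b; this b gives it the value -
        B u u - 2, which is negative.\<close>
      then show False using quad[of 1 "- (B u u + 1) / B u v"] True nonneg[OF assms(1)] by simp
    qed
    then show ?thesis using True by simp
  next
    case False
    then have "B v v > 0" using nonneg[OF assms(2)] by simp
    \<comment> \<open>The choice a = B v v, b = - B u v turns the quadratic form into B v v times
      the difference to be estimated.\<close>
    moreover have "0 \<le> B v v * (B u u * B v v - (B u v)\<^sup>2)"
      using quad[of "B v v" "- B u v"] by (simp add: power2_eq_square algebra_simps)
    ultimately show ?thesis by (simp add: zero_le_mult_iff)
  qed
qed

definition nrm :: "('a \<Rightarrow> real) \<Rightarrow> real" where "nrm u = sqrt (B u u)"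

lemma nrm_nonneg: "u \<in> V \<Longrightarrow> 0 \<le> nrm u"
  by (simp add: nrm_def nonneg)

lemma nrm_square: "u \<in> V \<Longrightarrow> (nrm u)\<^sup>2 = B u u"
  by (simp add: nrm_def nonneg)

lemma nrm_zero: "u \<in> V \<Longrightarrow> nrm (\<lambda>_. 0) = 0"
  using zero_left[OF zero_mem, of u] by (simp add: nrm_def)

lemma nrm_scale:
  assumes "u \<in> V"
  shows "nrm (\<lambda>x. c * u x) = \<bar>c\<bar> * nrm u"
proof -
  have cu: "(\<lambda>x. c * u x) \<in> V" using mem_combination[OF assms assms, of c 0] by simp
  have "B (\<lambda>x. c * u x) (\<lambda>x. c * u x) = c\<^sup>2 * B u u"
    using assms cu by (simp add: scale_right sym[OF cu assms] power2_eq_square)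
  then show ?thesis by (simp add: nrm_def real_sqrt_mult)
qed

lemma Cauchy_Schwarz: "u \<in> V \<Longrightarrow> v \<in> V \<Longrightarrow> \<bar>B u v\<bar> \<le> nrm u * nrm v"
  using Cauchy_Schwarz_square[of u v] unfolding nrm_def
  by (metis real_sqrt_abs real_sqrt_le_mono real_sqrt_mult)

lemma nrm_diff_le: "u \<in> V \<Longrightarrow> v \<in> V \<Longrightarrow> nrm (u - v) \<le> nrm u + nrm v"
proof (rule power2_le_imp_le)
  assume uv: "u \<in> V" "v \<in> V"
  then have "- 2 * B u v \<le> 2 * (nrm u * nrm v)" using Cauchy_Schwarz[OF uv] by simp
  then show "(nrm (u - v))\<^sup>2 \<le> (nrm u + nrm v)\<^sup>2"
    using uv by (simp add: nrm_square diff_mem square_diff power2_sum)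
qed (simp add: nrm_nonneg)

lemma nrm_minus_commute: "u \<in> V \<Longrightarrow> v \<in> V \<Longrightarrow> nrm (u - v) = nrm (v - u)"
  by (simp add: nrm_def square_diff sym)

lemma nrm_triangle: "u \<in> V \<Longrightarrow> v \<in> V \<Longrightarrow> w \<in> V \<Longrightarrow> nrm (u - w) \<le> nrm (u - v) + nrm (w - v)"
proof -
  assume V: "u \<in> V" "v \<in> V" "w \<in> V"
  have "u - w = (u - v) - (w - v)" by (simp add: fun_eq_iff)
  then show ?thesis using nrm_diff_le[of "u - v" "w - v"] V by (simp only: diff_mem)
qed

text \<open>No bound on \<open>v\<close> is needed: the left-hand side is negative unless \<open>nrm (u - v) \<le> nrm (u - w)\<close>.\<close>

lemma nrm_square_diff_le:
  assumes V: "u \<in> V" "v \<in> V" "w \<in> V" and c: "nrm (u - w) \<le> c"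
  shows "(nrm (u - w))\<^sup>2 - (nrm (u - v))\<^sup>2 \<le> 2 * c * nrm (w - v)"
proof -
  define a b d where "a = nrm (u - w)" "b = nrm (u - v)" "d = nrm (w - v)"
  note abd = this
  have nn: "0 \<le> a" "0 \<le> b" "0 \<le> d" using V by (simp_all add: abd nrm_nonneg diff_mem)
  have tri: "a \<le> b + d" using nrm_triangle[OF V] by (simp add: abd)
  have ac: "a \<le> c" using c by (simp add: abd)
  have "a\<^sup>2 - b\<^sup>2 \<le> 2 * c * d"
  proof (cases "a \<le> b")
    case True
    then have "a\<^sup>2 \<le> b\<^sup>2" using nn by (intro power_mono)
    moreover have "0 \<le> 2 * c * d" using nn ac by simp
    ultimately show ?thesis by linarith
  next
    case False
    have "a\<^sup>2 - b\<^sup>2 = (a - b) * (a + b)" by (simp add: power2_eq_square algebra_simps)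
    also have "\<dots> \<le> d * (2 * c)" using False nn tri ac by (intro mult_mono) auto
    finally show ?thesis by (simp add: mult_ac)
  qed
  then show ?thesis by (simp add: abd)
qed

end

section \<open>The L2 product as an instance\<close>

lemma semi_inner_L2: "semi_inner (L2 M) (\<lambda>u v. \<integral>x. u x * v x \<partial>M)"
proof
  show "(\<integral>x. (a * u x + b * v x) * w x \<partial>M) = a * (\<integral>x. u x * w x \<partial>M) + b * (\<integral>x. v x * w x \<partial>M)"
    if uvw: "u \<in> L2 M" "v \<in> L2 M" "w \<in> L2 M" for u v w a b
  proof -
    have "(\<integral>x. (a * u x + b * v x) * w x \<partial>M) = (\<integral>x. a * (u x * w x) + b * (v x * w x) \<partial>M)"
      by (simp add: algebra_simps)
    also have "\<dots> = a * (\<integral>x. u x * w x \<partial>M) + b * (\<integral>x. v x * w x \<partial>M)"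
      using integrable_mult_L2[OF uvw(1,3)] integrable_mult_L2[OF uvw(2,3)] by simp
    finally show ?thesis .
  qed
qed (simp_all add: L2_linear_combination mult.commute)

lemma L2_norm_eq_nrm: "L2_norm M = semi_inner.nrm (\<lambda>u v. \<integral>x. u x * v x \<partial>M)"
  by (rule ext) (simp add: L2_norm_def semi_inner.nrm_def[OF semi_inner_L2] power2_eq_square)

lemmas L2_diff = semi_inner.diff_mem[OF semi_inner_L2]
lemmas L2_norm_nonneg = semi_inner.nrm_nonneg[OF semi_inner_L2, folded L2_norm_eq_nrm]
lemmas L2_norm_diff_le = semi_inner.nrm_diff_le[OF semi_inner_L2, folded L2_norm_eq_nrm]
lemmas L2_Cauchy_Schwarz = semi_inner.Cauchy_Schwarz[OF semi_inner_L2, folded L2_norm_eq_nrm]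

lemma L2_norm_square: "(L2_norm M u)\<^sup>2 = (\<integral>x. (u x)\<^sup>2 \<partial>M)"
  by (simp add: L2_norm_def integral_nonneg_AE)

lemma L2_norm_cong_AE:
  assumes "u \<in> L2 M" "v \<in> L2 M" "AE x in M. u x = v x"
  shows "L2_norm M u = L2_norm M v"
proof -
  have "(\<integral>x. (u x)\<^sup>2 \<partial>M) = (\<integral>x. (v x)\<^sup>2 \<partial>M)"
    using assms L2_D(2)[THEN borel_measurable_integrable]
    by (intro integral_cong_AE) auto
  then show ?thesis by (simp add: L2_norm_def)
qed

section \<open>The H1 product and the energy form as instances\<close>

lemma integrable_opA:
  assumes "u \<in> H1 \<Omega>" "v \<in> H1 \<Omega>"
  shows "integrable (lebesgue_on \<Omega>) (\<lambda>x. wgrad \<Omega> u x \<bullet> wgrad \<Omega> v x + k * u x * v x)"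
  unfolding inner_vec_def inner_real_def mult.assoc using H1_D[OF assms(1)] H1_D[OF assms(2)]
  by (intro Bochner_Integration.integrable_add Bochner_Integration.integrable_sum
      Bochner_Integration.integrable_mult_right integrable_mult_L2)

lemma semi_inner_H1:
  assumes \<Omega>: "open \<Omega>" "bounded \<Omega>" and k: "k \<ge> 0"
  shows "semi_inner (H1 \<Omega>) (opA \<Omega> k)"
proof
  show "(\<lambda>x. a * u x + b * v x) \<in> H1 \<Omega>" if "u \<in> H1 \<Omega>" "v \<in> H1 \<Omega>" for u v a b
    using H1_linear_combination(1)[OF \<Omega> that] .
  show "opA \<Omega> k (\<lambda>x. a * u x + b * v x) w = a * opA \<Omega> k u w + b * opA \<Omega> k v w"
    if uvw: "u \<in> H1 \<Omega>" "v \<in> H1 \<Omega>" "w \<in> H1 \<Omega>" for u v w a b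
  proof -
    let ?M = "lebesgue_on \<Omega>"
    let ?I = "\<lambda>u x. wgrad \<Omega> u x \<bullet> wgrad \<Omega> w x + k * u x * w x"
    note int = integrable_opA[OF uvw(1,3), of k] integrable_opA[OF uvw(2,3), of k]
    have "opA \<Omega> k (\<lambda>x. a * u x + b * v x) w = (\<integral>x. a * ?I u x + b * ?I v x \<partial>?M)"
      unfolding opA_def
    proof (rule integral_cong_AE)
      show "?I (\<lambda>x. a * u x + b * v x) \<in> borel_measurable ?M"
        using integrable_opA[OF H1_linear_combination(1)[OF \<Omega> uvw(1,2)] uvw(3)] by blast
      show "(\<lambda>x. a * ?I u x + b * ?I v x) \<in> borel_measurable ?M"
        by (intro borel_measurable_integrable Bochner_Integration.integrable_add
            Bochner_Integration.integrable_mult_right int)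
      show "AE x in ?M. ?I (\<lambda>x. a * u x + b * v x) x = a * ?I u x + b * ?I v x"
        using H1_linear_combination(2)[OF \<Omega> uvw(1,2), of a b]
        by eventually_elim (simp add: inner_add_left algebra_simps)
    qed
    also have "\<dots> = a * opA \<Omega> k u w + b * opA \<Omega> k v w"
      using int by (simp add: opA_def)
    finally show ?thesis .
  qed
  show "opA \<Omega> k u v = opA \<Omega> k v u" for u v
    unfolding opA_def by (simp add: inner_commute mult_ac)
  show "opA \<Omega> k u u \<ge> 0" for u
    unfolding opA_def using k by (intro integral_nonneg_AE AE_I2) (simp add: mult.assoc)
qed

lemma H1_norm_eq_nrm:
  assumes "open \<Omega>" "bounded \<Omega>"
  shows "H1_norm \<Omega> = semi_inner.nrm (opA \<Omega> 1)"
  by (rule ext) (simp add: H1_norm_def opA_def semi_inner.nrm_def[OF semi_inner_H1[OF assms, of 1]]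
      dot_square_norm power2_eq_square[symmetric] add.commute)

text \<open>The gradient part has coefficient 1 and the zero-order part coefficient
  \<open>k\<close>, so the energy form is at most \<open>max 1 k\<close> times the H1 form. The
  bound serves to show that the functionals below have finite dual norm; the error estimate itself
  uses \<open>C_b\<close>.\<close>

lemma opA_bounded:
  assumes \<Omega>: "open \<Omega>" "bounded \<Omega>" and k: "k \<ge> 0" and uw: "u \<in> H1 \<Omega>" "w \<in> H1 \<Omega>"
  shows "\<bar>opA \<Omega> k u w\<bar> \<le> max 1 k * H1_norm \<Omega> u * H1_norm \<Omega> w"
proof -
  interpret A: semi_inner "H1 \<Omega>" "opA \<Omega> k" by (rule semi_inner_H1[OF \<Omega> k])
  interpret I: semi_inner "H1 \<Omega>" "opA \<Omega> 1" by (rule semi_inner_H1[OF \<Omega>]) simp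
  have le: "A.nrm v \<le> sqrt (max 1 k) * H1_norm \<Omega> v" if v: "v \<in> H1 \<Omega>" for v
  proof -
    have "opA \<Omega> k v v \<le> (\<integral>x. max 1 k * (wgrad \<Omega> v x \<bullet> wgrad \<Omega> v x + 1 * v x * v x) \<partial>lebesgue_on \<Omega>)"
      unfolding opA_def
    proof (rule integral_mono)
      fix x
      have "1 * (wgrad \<Omega> v x \<bullet> wgrad \<Omega> v x) \<le> max 1 k * (wgrad \<Omega> v x \<bullet> wgrad \<Omega> v x)"
        "k * (v x * v x) \<le> max 1 k * (v x * v x)"
        by (intro mult_right_mono; simp)+
      then show "wgrad \<Omega> v x \<bullet> wgrad \<Omega> v x + k * v x * v x
          \<le> max 1 k * (wgrad \<Omega> v x \<bullet> wgrad \<Omega> v x + 1 * v x * v x)"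
        by (simp add: distrib_left mult.assoc del: max.bounded_iff)
    qed (intro Bochner_Integration.integrable_mult_right integrable_opA v)+
    also have "\<dots> = max 1 k * opA \<Omega> 1 v v" by (simp add: opA_def)
    finally show ?thesis
      unfolding H1_norm_eq_nrm[OF \<Omega>] A.nrm_def I.nrm_def
      by (metis real_sqrt_le_mono real_sqrt_mult)
  qed
  have "\<bar>opA \<Omega> k u w\<bar> \<le> A.nrm u * A.nrm w" using uw by (rule A.Cauchy_Schwarz)
  also have "\<dots> \<le> (sqrt (max 1 k) * H1_norm \<Omega> u) * (sqrt (max 1 k) * H1_norm \<Omega> w)"
    using uw by (intro mult_mono le A.nrm_nonneg mult_nonneg_nonneg)
      (auto simp: H1_norm_eq_nrm[OF \<Omega>] I.nrm_nonneg)
  also have "\<dots> = (sqrt (max 1 k) * sqrt (max 1 k)) * H1_norm \<Omega> u * H1_norm \<Omega> w"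
    by (simp only: mult_ac)
  also have "sqrt (max 1 k) * sqrt (max 1 k) = max 1 k" by simp
  finally show ?thesis .
qed

lemma L2_norm_le_H1_norm:
  assumes "u \<in> H1 \<Omega>"
  shows "L2_norm (lebesgue_on \<Omega>) u \<le> H1_norm \<Omega> u"
proof -
  have "integrable (lebesgue_on \<Omega>) (\<lambda>x. (u x)\<^sup>2 + (norm (wgrad \<Omega> u x))\<^sup>2)"
    using integrable_opA[OF assms assms, of 1]
    by (simp add: dot_square_norm power2_eq_square[symmetric] add.commute)
  then have "(\<integral>x. (u x)\<^sup>2 \<partial>lebesgue_on \<Omega>) \<le> (\<integral>x. (u x)\<^sup>2 + (norm (wgrad \<Omega> u x))\<^sup>2 \<partial>lebesgue_on \<Omega>)"
    using L2_D(2)[OF H1_D(1)[OF assms]] by (intro integral_mono) auto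
  then show ?thesis by (simp add: L2_norm_def H1_norm_def)
qed

section \<open>Dual norms\<close>

lemma src_bounded:
  assumes "f \<in> L2 (lebesgue_on \<Omega>)" "w \<in> H1 \<Omega>"
  shows "\<bar>src \<Omega> f w\<bar> \<le> L2_norm (lebesgue_on \<Omega>) f * H1_norm \<Omega> w"
proof -
  have "\<bar>src \<Omega> f w\<bar> \<le> L2_norm (lebesgue_on \<Omega>) f * L2_norm (lebesgue_on \<Omega>) w"
    unfolding src_def by (rule L2_Cauchy_Schwarz[OF assms(1) H1_D(1)[OF assms(2)]])
  also have "\<dots> \<le> L2_norm (lebesgue_on \<Omega>) f * H1_norm \<Omega> w"
    using L2_norm_le_H1_norm[OF assms(2)] by (intro mult_left_mono L2_norm_nonneg[OF assms(1)])
  finally show ?thesis .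
qed

lemma src_diff:
  assumes "f \<in> L2 (lebesgue_on \<Omega>)" "v \<in> H1 \<Omega>" "w \<in> H1 \<Omega>"
  shows "src \<Omega> f (v - w) = src \<Omega> f v - src \<Omega> f w"
  unfolding src_def
  using semi_inner.diff_right[OF semi_inner_L2 H1_D(1)[OF assms(2)] H1_D(1)[OF assms(3)] assms(1)] .

lemma src_scale: "src \<Omega> f (\<lambda>x. c * w x) = c * src \<Omega> f w"
proof -
  have "src \<Omega> f (\<lambda>x. c * w x) = (\<integral>x. c * (f x * w x) \<partial>lebesgue_on \<Omega>)"
    unfolding src_def by (simp add: mult_ac)
  then show ?thesis by (simp add: src_def)
qed

text \<open>\<open>C\<close> only certifies that the real supremum in \<open>dual_norm\<close> is
  over a bounded set; it does not appear in the result. Rescaling to the unit sphere fails when the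
  seminorm of \<open>w\<close> is zero, and there the bound with \<open>C\<close> forces
  \<open>l w = 0\<close>.\<close>

lemma dual_norm_bound:
  assumes \<Omega>: "open \<Omega>" "bounded \<Omega>"
    and scale: "\<And>c w. w \<in> H1 \<Omega> \<Longrightarrow> l (\<lambda>x. c * w x) = c * l w"
    and bounded: "\<And>w. w \<in> H1 \<Omega> \<Longrightarrow> \<bar>l w\<bar> \<le> C * H1_norm \<Omega> w"
    and w: "w \<in> H1 \<Omega>"
  shows "\<bar>l w\<bar> \<le> dual_norm \<Omega> l * H1_norm \<Omega> w" "0 \<le> dual_norm \<Omega> l"
proof -
  interpret I: semi_inner "H1 \<Omega>" "opA \<Omega> 1" by (rule semi_inner_H1[OF \<Omega>]) simp
  note nrm = H1_norm_eq_nrm[OF \<Omega>]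
  let ?U = "{w \<in> H1 \<Omega>. H1_norm \<Omega> w \<le> 1}"
  have bdd: "bdd_above ((\<lambda>w. \<bar>l w\<bar>) ` ?U)"
  proof (rule bdd_aboveI2)
    fix v assume v: "v \<in> ?U"
    have "\<bar>l v\<bar> \<le> C * H1_norm \<Omega> v" using bounded v by simp
    also have "\<dots> \<le> \<bar>C\<bar> * 1"
      using v by (intro mult_mono) (auto simp: nrm I.nrm_nonneg)
    finally show "\<bar>l v\<bar> \<le> \<bar>C\<bar>" by simp
  qed
  have upper: "\<bar>l v\<bar> \<le> dual_norm \<Omega> l" if "v \<in> H1 \<Omega>" "H1_norm \<Omega> v \<le> 1" for v
    unfolding dual_norm_def by (rule cSUP_upper[OF _ bdd]) (use that in simp)
  \<comment> \<open>The zero function lies in the unit ball, so the supremum dominates an absolute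
    value and is nonnegative.\<close>
  have "(\<lambda>_. 0) \<in> H1 \<Omega>" "H1_norm \<Omega> (\<lambda>_. 0) = 0" using w by (simp_all add: I.zero_mem nrm I.nrm_zero)
  then have "\<bar>l (\<lambda>_. 0)\<bar> \<le> dual_norm \<Omega> l" by (intro upper) auto
  then show "0 \<le> dual_norm \<Omega> l" by linarith
  show "\<bar>l w\<bar> \<le> dual_norm \<Omega> l * H1_norm \<Omega> w"
  proof (cases "H1_norm \<Omega> w = 0")
    case True
    then show ?thesis using bounded[OF w] by simp
  next
    case False
    then have pos: "H1_norm \<Omega> w > 0" using I.nrm_nonneg[OF w] by (simp add: nrm)
    let ?c = "inverse (H1_norm \<Omega> w)"
    have "\<bar>l (\<lambda>x. ?c * w x)\<bar> \<le> dual_norm \<Omega> l"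
    proof (rule upper)
      show "(\<lambda>x. ?c * w x) \<in> H1 \<Omega>" using I.mem_combination[OF w w, of ?c 0] by simp
      show "H1_norm \<Omega> (\<lambda>x. ?c * w x) \<le> 1"
        using I.nrm_scale[OF w, of ?c] pos by (simp add: nrm)
    qed
    then have "?c * \<bar>l w\<bar> \<le> dual_norm \<Omega> l"
      using pos by (simp add: scale[OF w] abs_mult)
    then show ?thesis using pos by (simp add: field_simps)
  qed
qed

section \<open>Penalty terms\<close>

text \<open>The positive part of \<open>\<psi> - w\<close> is at most the absolute value of
  \<open>w - \<psi>\<close>, and, since \<open>\<psi> \<le> v\<close>, also at most that of
  \<open>w - v\<close>. Using one bound for each factor of the square and Cauchy-Schwarz makes the
  estimate linear in the distance to \<open>v\<close>.\<close>

lemma L_obst_bound: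
  assumes \<psi>: "\<psi> \<in> L2 (lebesgue_on \<Omega>)" and v: "v \<in> L2 (lebesgue_on \<Omega>)" and w: "w \<in> L2 (lebesgue_on \<Omega>)"
    and above: "AE x in lebesgue_on \<Omega>. \<psi> x \<le> v x"
  shows "L_obst \<Omega> \<psi> w
    \<le> (L2_norm (lebesgue_on \<Omega>) w + L2_norm (lebesgue_on \<Omega>) \<psi>) * L2_norm (lebesgue_on \<Omega>) (w - v)"
proof -
  let ?M = "lebesgue_on \<Omega>"
  have abs_L2: "(\<lambda>x. \<bar>u x\<bar>) \<in> L2 ?M" if "u \<in> L2 ?M" for u
    using that by (auto simp: L2_def)
  note a = abs_L2[OF L2_diff[OF w \<psi>]] and b = abs_L2[OF L2_diff[OF w v]]
  have norm_abs: "L2_norm ?M (\<lambda>x. \<bar>u x\<bar>) = L2_norm ?M u" for u by (simp add: L2_norm_def)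
  have "L_obst \<Omega> \<psi> w \<le> (\<integral>x. \<bar>(w - \<psi>) x\<bar> * \<bar>(w - v) x\<bar> \<partial>?M)"
    unfolding L_obst_def
  proof (rule integral_mono_AE')
    show "AE x in ?M. (max 0 (\<psi> x - w x))\<^sup>2 \<le> \<bar>(w - \<psi>) x\<bar> * \<bar>(w - v) x\<bar>"
      using above
    proof eventually_elim
      case (elim x)
      have "max 0 (\<psi> x - w x) * max 0 (\<psi> x - w x) \<le> \<bar>(w - \<psi>) x\<bar> * \<bar>(w - v) x\<bar>"
        using elim by (intro mult_mono) auto
      then show ?case by (simp add: power2_eq_square)
    qed
  qed (use integrable_mult_L2[OF a b] in auto)
  also have "\<dots> \<le> L2_norm ?M (w - \<psi>) * L2_norm ?M (w - v)"
    using L2_Cauchy_Schwarz[OF a b, unfolded norm_abs] by linarith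
  also have "\<dots> \<le> (L2_norm ?M w + L2_norm ?M \<psi>) * L2_norm ?M (w - v)"
    by (intro mult_right_mono L2_norm_diff_le L2_norm_nonneg L2_diff w \<psi> v)
  finally show ?thesis .
qed

lemma L2_norm_trace_diff:
  assumes tr: "trace_operator \<Omega> tr" and w: "w \<in> H1 \<Omega>" and v: "v \<in> H1 \<Omega>" and wv: "w - v \<in> H1 \<Omega>"
    and h: "h \<in> L2 (surface_measure \<Omega>)" "AE x in surface_measure \<Omega>. tr v x = h x"
  shows "L2_norm (surface_measure \<Omega>) (tr (w - v)) = L2_norm (surface_measure \<Omega>) (tr w - h)"
proof (rule L2_norm_cong_AE)
  have "AE x in surface_measure \<Omega>. tr (\<lambda>y. 1 * w y + (- 1) * v y) x = 1 * tr w x + (- 1) * tr v x"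
    using tr w v unfolding trace_operator_def by blast
  moreover have "(\<lambda>y. 1 * w y + (- 1) * v y) = w - v" by (simp add: fun_eq_iff)
  ultimately have "AE x in surface_measure \<Omega>. tr (w - v) x = tr w x - tr v x" by simp
  with h(2) show "AE x in surface_measure \<Omega>. tr (w - v) x = (tr w - h) x"
    by eventually_elim simp
qed (use tr w wv h in \<open>auto simp: trace_operator_def intro!: L2_diff\<close>)

text \<open>As the trace of \<open>v\<close> is \<open>h\<close>, the defect \<open>tr w - h\<close>
  has the same norm as the trace of \<open>w - v\<close>. One factor of the square is kept in that
  form, the other is split by the triangle inequality.\<close>

lemma L_bdry_bound:
  assumes tr: "trace_operator \<Omega> tr" and w: "w \<in> H1 \<Omega>" and v: "v \<in> H1 \<Omega>" and wv: "w - v \<in> H1 \<Omega>"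
    and h: "h \<in> L2 (surface_measure \<Omega>)" "AE x in surface_measure \<Omega>. tr v x = h x"
  shows "L_bdry \<Omega> tr h w
    \<le> (L2_norm (surface_measure \<Omega>) (tr w) + L2_norm (surface_measure \<Omega>) h)
        * L2_norm (surface_measure \<Omega>) (tr (w - v))"
proof -
  let ?S = "surface_measure \<Omega>"
  have tw: "tr w \<in> L2 ?S" using tr w by (simp add: trace_operator_def)
  have "L_bdry \<Omega> tr h w = L2_norm ?S (tr w - h) * L2_norm ?S (tr w - h)"
    using L2_norm_square[of ?S "tr w - h"] by (simp add: L_bdry_def power2_eq_square)
  also have "\<dots> \<le> (L2_norm ?S (tr w) + L2_norm ?S h) * L2_norm ?S (tr w - h)"
    by (intro mult_right_mono L2_norm_diff_le L2_norm_nonneg L2_diff tw h)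
  finally show ?thesis unfolding L2_norm_trace_diff[OF assms] .
qed

lemma R_pen_nonneg: "wb \<ge> 0 \<Longrightarrow> wo \<ge> 0 \<Longrightarrow> 0 \<le> R_pen \<Omega> tr \<psi> h wb wo u"
  unfolding R_pen_def L_bdry_def L_obst_def
  by (intro add_nonneg_nonneg mult_nonneg_nonneg integral_nonneg_AE AE_I2) auto

lemma dR_pen_nonneg: "wb \<ge> 0 \<Longrightarrow> wo \<ge> 0 \<Longrightarrow> 0 \<le> dR_pen \<Omega> \<psi> h N x Nb xb wb wo u"
  unfolding dR_pen_def dL_bdry_def dL_obst_def
  by (intro add_nonneg_nonneg mult_nonneg_nonneg sum_nonneg) auto

lemma R_pen_eq_0:
  assumes "v \<in> obstacle_set \<Omega> tr \<psi> h"
  shows "R_pen \<Omega> tr \<psi> h wb wo v = 0"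
proof -
  have "AE x in lebesgue_on \<Omega>. (max 0 (\<psi> x - v x))\<^sup>2 = 0"
    "AE x in surface_measure \<Omega>. (tr v x - h x)\<^sup>2 = 0"
    using assms by (auto simp: obstacle_set_def)
  then have "L_obst \<Omega> \<psi> v = 0" "L_bdry \<Omega> tr h v = 0"
    unfolding L_obst_def L_bdry_def by (auto intro: integral_eq_zero_AE)
  then show ?thesis by (simp add: R_pen_def)
qed

text \<open>The constants \<open>co\<close> and \<open>cb\<close> are left free because the bound is
  used twice: for \<open>R2\<close> at a test network against a member of
  \<open>K \<inter> Y\<close>, and for \<open>R1\<close> at a solution network against
  \<open>ustar\<close>.\<close>

lemma R_pen_bound:
  assumes tr: "trace_operator \<Omega> tr" and \<psi>: "\<psi> \<in> H1 \<Omega>" and h: "h \<in> H_half \<Omega>"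
    and v: "v \<in> obstacle_set \<Omega> tr \<psi> h" and w: "w \<in> H1 \<Omega>" and wv: "w - v \<in> H1 \<Omega>"
    and weights: "wb \<ge> 0" "wo \<ge> 0"
    and bounds: "L2_norm (lebesgue_on \<Omega>) w + L2_norm (lebesgue_on \<Omega>) \<psi> \<le> co"
      "L2_norm (surface_measure \<Omega>) (tr w) + L2_norm (surface_measure \<Omega>) h \<le> cb"
  shows "R_pen \<Omega> tr \<psi> h wb wo w
    \<le> wo * co * L2_norm (lebesgue_on \<Omega>) (w - v) + wb * cb * L2_norm (surface_measure \<Omega>) (tr (w - v))"
proof -
  have v': "v \<in> H1 \<Omega>" "AE x in lebesgue_on \<Omega>. \<psi> x \<le> v x" "AE x in surface_measure \<Omega>. tr v x = h x"
    using v by (auto simp: obstacle_set_def)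
  have "h \<in> L2 (surface_measure \<Omega>)" using h by (simp add: H_half_def)
  from L_bdry_bound[OF tr w v'(1) wv this v'(3)]
  have "L_bdry \<Omega> tr h w \<le> cb * L2_norm (surface_measure \<Omega>) (tr (w - v))"
    by (rule order_trans[OF _ mult_right_mono[OF bounds(2) L2_norm_nonneg]])
       (use tr wv in \<open>unfold trace_operator_def, blast\<close>)
  moreover from L_obst_bound[OF H1_D(1)[OF \<psi>] H1_D(1)[OF v'(1)] H1_D(1)[OF w] v'(2)]
  have "L_obst \<Omega> \<psi> w \<le> co * L2_norm (lebesgue_on \<Omega>) (w - v)"
    by (rule order_trans[OF _ mult_right_mono[OF bounds(1) L2_norm_nonneg[OF H1_D(1)[OF wv]]]])
  ultimately show ?thesis
    unfolding R_pen_def mult.assoc using weights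
    by (subst add.commute) (intro add_mono mult_left_mono)
qed


section \<open>The loss functional\<close>

lemma resid_diff:
  assumes "open \<Omega>" "bounded \<Omega>" "k \<ge> 0" "f \<in> L2 (lebesgue_on \<Omega>)" "u \<in> H1 \<Omega>" "v \<in> H1 \<Omega>" "w \<in> H1 \<Omega>"
  shows "resid \<Omega> k f u (v - w) = resid \<Omega> k f u v - resid \<Omega> k f u w"
  using semi_inner.diff_right[OF semi_inner_H1[OF assms(1-3)] assms(6,7,5)] src_diff[OF assms(4,6,7)]
  by (simp add: resid_def)

lemma resid_dual_bound:
  assumes \<Omega>: "open \<Omega>" "bounded \<Omega>" "k \<ge> 0" and f: "f \<in> L2 (lebesgue_on \<Omega>)"
    and u: "u \<in> H1 \<Omega>" and w: "w \<in> H1 \<Omega>"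
  shows "\<bar>resid \<Omega> k f u w\<bar> \<le> dual_norm \<Omega> (resid \<Omega> k f u) * H1_norm \<Omega> w"
    and "0 \<le> dual_norm \<Omega> (resid \<Omega> k f u)"
proof -
  have scale: "resid \<Omega> k f u (\<lambda>x. c * v x) = c * resid \<Omega> k f u v" if "v \<in> H1 \<Omega>" for c v
    using semi_inner.scale_right[OF semi_inner_H1[OF \<Omega>] that u, of c]
    by (simp add: resid_def src_scale right_diff_distrib)
  have bound: "\<bar>resid \<Omega> k f u v\<bar> \<le> (max 1 k * H1_norm \<Omega> u + L2_norm (lebesgue_on \<Omega>) f) * H1_norm \<Omega> v"
    if "v \<in> H1 \<Omega>" for v
    using opA_bounded[OF \<Omega> u that] src_bounded[OF f that] by (simp add: resid_def distrib_right)
  show "\<bar>resid \<Omega> k f u w\<bar> \<le> dual_norm \<Omega> (resid \<Omega> k f u) * H1_norm \<Omega> w"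
    "0 \<le> dual_norm \<Omega> (resid \<Omega> k f u)"
    using dual_norm_bound[of \<Omega> "resid \<Omega> k f u", OF \<Omega>(1,2) scale bound w] by blast+
qed

text \<open>By linearity the difference of the two functionals is the form at \<open>u - v\<close>.
  With \<open>v = 0\<close> this yields continuity of the form with the constant \<open>C_b\<close>
  of the hypothesis.\<close>

lemma opA_diff_bound:
  assumes \<Omega>: "open \<Omega>" "bounded \<Omega>" "k \<ge> 0"
    and u: "u \<in> H1 \<Omega>" and v: "v \<in> H1 \<Omega>" and w: "w \<in> H1 \<Omega>"
    and lip: "dual_norm \<Omega> (\<lambda>w. opA \<Omega> k u w - opA \<Omega> k v w) \<le> C * H1_norm \<Omega> (u - v)"
  shows "\<bar>opA \<Omega> k (u - v) w\<bar> \<le> C * H1_norm \<Omega> (u - v) * H1_norm \<Omega> w"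
proof -
  interpret A: semi_inner "H1 \<Omega>" "opA \<Omega> k" by (rule semi_inner_H1[OF \<Omega>])
  interpret I: semi_inner "H1 \<Omega>" "opA \<Omega> 1" by (rule semi_inner_H1[OF \<Omega>(1,2)]) simp
  let ?l = "\<lambda>w. opA \<Omega> k u w - opA \<Omega> k v w"
  have l: "?l w = opA \<Omega> k (u - v) w" if "w \<in> H1 \<Omega>" for w
    using A.diff_left[OF u v that] by simp
  have "\<bar>?l w\<bar> \<le> dual_norm \<Omega> ?l * H1_norm \<Omega> w"
  proof (rule dual_norm_bound(1)[OF \<Omega>(1,2) _ _ w])
    show "?l (\<lambda>x. c * w x) = c * ?l w" if "w \<in> H1 \<Omega>" for c w
      using A.scale_right[OF that u] A.scale_right[OF that v] by (simp add: right_diff_distrib)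
    show "\<bar>?l w\<bar> \<le> (max 1 k * H1_norm \<Omega> (u - v)) * H1_norm \<Omega> w" if "w \<in> H1 \<Omega>" for w
      using opA_bounded[OF \<Omega> A.diff_mem[OF u v] that] l[OF that] by simp
  qed
  also have "\<dots> \<le> C * H1_norm \<Omega> (u - v) * H1_norm \<Omega> w"
    using lip by (intro mult_right_mono) (auto simp: H1_norm_eq_nrm[OF \<Omega>(1,2)] I.nrm_nonneg[OF w])
  finally show ?thesis using l[OF w] by simp
qed

text \<open>For fixed \<open>u\<close> the discrete loss is a concave quadratic in the nodal values and gradients of
  \<open>v\<close>; completing the square bounds it although \<open>v\<close> itself is unbounded at the nodes.\<close>

lemma dL_gamma_bounded_above:
  assumes "\<gamma> > 0"
  obtains C where "\<And>v. dL_gamma \<Omega> k f \<gamma> N x u v \<le> C"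
proof
  fix v
  define c where "c = measure lebesgue \<Omega> / real N"
  define a where "a i = grad u (x i)" for i
  define p where "p i = grad u (x i) - grad v (x i)" for i
  define e where "e i = k * u (x i) - f (x i)" for i
  define s where "s i = u (x i) - v (x i)" for i
  \<comment> \<open>Young's inequality with weight \<open>\<gamma>\<close>: the left-hand side is
    largest at s' = \<gamma> t, where equality holds.\<close>
  have young: "t * s' - s'\<^sup>2 / (2 * \<gamma>) \<le> \<gamma> / 2 * t\<^sup>2" for s' t :: real
  proof -
    have "0 \<le> (\<gamma> * t - s')\<^sup>2 / (2 * \<gamma>)" using assms by simp
    also have "\<dots> = \<gamma> / 2 * t\<^sup>2 - (t * s' - s'\<^sup>2 / (2 * \<gamma>))"
      using assms by (simp add: power2_diff power_mult_distrib field_simps power2_eq_square)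
    finally show ?thesis by simp
  qed
  have "dL_gamma \<Omega> k f \<gamma> N x u v
      = c * (\<Sum>i=1..N. (a i \<bullet> p i - (norm (p i))\<^sup>2 / (2 * \<gamma>)) + (e i * s i - (s i)\<^sup>2 / (2 * \<gamma>)))"
    unfolding dL_gamma_def dL_def
    by (simp add: c_def a_def p_def e_def s_def sum_subtractf sum.distrib sum_divide_distrib[symmetric]
        algebra_simps add_divide_distrib diff_divide_distrib)
  also have "\<dots> \<le> c * (\<Sum>i=1..N. \<gamma> / 2 * (norm (a i))\<^sup>2 + \<gamma> / 2 * (e i)\<^sup>2)"
  proof (intro mult_left_mono sum_mono add_mono young)
    fix i
    have "a i \<bullet> p i \<le> norm (a i) * norm (p i)" by (rule norm_cauchy_schwarz)
    with young[of "norm (a i)" "norm (p i)"]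
    show "a i \<bullet> p i - (norm (p i))\<^sup>2 / (2 * \<gamma>) \<le> \<gamma> / 2 * (norm (a i))\<^sup>2" by linarith
  qed (simp add: c_def)
  finally show "dL_gamma \<Omega> k f \<gamma> N x u v \<le> measure lebesgue \<Omega> / real N *
      (\<Sum>i=1..N. \<gamma> / 2 * (norm (grad u (x i)))\<^sup>2 + \<gamma> / 2 * (k * u (x i) - f (x i))\<^sup>2)"
    by (simp add: c_def a_def e_def)
qed

text \<open>Finiteness of suprema such as \<open>dG u\<close> and \<open>H ustar\<close>, so that
  subtracting them in \<open>ereal\<close> is ordinary subtraction.\<close>

lemma SUP_ereal_real:
  assumes "A \<noteq> {}" "\<And>v. v \<in> A \<Longrightarrow> g v \<le> (C::real)"
  shows "\<exists>c. (SUP v\<in>A. ereal (g v)) = ereal c"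
proof -
  have "(SUP v\<in>A. ereal (g v)) \<le> ereal C" by (rule SUP_least) (simp add: assms)
  moreover obtain v where "v \<in> A" using assms by blast
  then have "ereal (g v) \<le> (SUP v\<in>A. ereal (g v))" by (rule SUP_upper)
  ultimately show ?thesis by (cases "SUP v\<in>A. ereal (g v)") auto
qed

section \<open>The error estimate for a computed solution of the obstacle problem\<close>

theorem mainTheorem4:
  fixes \<Omega> :: "(real^'n) set"
    and tr :: "(real^'n \<Rightarrow> real) \<Rightarrow> real^'n \<Rightarrow> real"
    and f h \<psi> ustar u_hat u_A :: "real^'n \<Rightarrow> real"
    and K X Y Xs Xt :: "(real^'n \<Rightarrow> real) set"
    and k C_a C_b \<gamma> r wb1 wo1 wb2 wo2 Ms Bs Mt Bt C1 K1 K2 K3 K4 K5 K6 :: real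
    and N Nb :: nat
    and x xb :: "nat \<Rightarrow> real^'n"
    and Lg dLg :: "(real^'n \<Rightarrow> real) \<Rightarrow> (real^'n \<Rightarrow> real) \<Rightarrow> real"
    and R1 R2 dR1 dR2 :: "(real^'n \<Rightarrow> real) \<Rightarrow> real"
    and G H dG :: "(real^'n \<Rightarrow> real) \<Rightarrow> ereal"
  assumes domain: "lipschitz_domain \<Omega>" "bounded \<Omega>"
    and trace: "trace_operator \<Omega> tr"
    and f: "f \<in> L2 (lebesgue_on \<Omega>)" "continuous_on \<Omega> f"
    and h: "h \<in> H_half \<Omega>" "continuous_on (frontier \<Omega>) h"
    and psi: "\<psi> \<in> H1 \<Omega>" "continuous_on \<Omega> \<psi>" "AE y in surface_measure \<Omega>. tr \<psi> y \<le> h y"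
    and K: "K = obstacle_set \<Omega> tr \<psi> h"
    and k: "k \<ge> 0"
    and CaCb: "C_b > 0" "C_a > 0"
    and A_lipschitz: "\<And>u v. u \<in> H1 \<Omega> \<Longrightarrow> v \<in> H1 \<Omega> \<Longrightarrow>
          dual_norm \<Omega> (\<lambda>w. opA \<Omega> k u w - opA \<Omega> k v w) \<le> C_b * H1_norm \<Omega> (u - v)"
    and A_coercive: "\<And>u v. u \<in> H1 \<Omega> \<Longrightarrow> v \<in> H1 \<Omega> \<Longrightarrow>
          opA \<Omega> k u (u - v) - opA \<Omega> k v (u - v) \<ge> C_a * (H1_norm \<Omega> (u - v))\<^sup>2"
    and ustar: "solves_VI \<Omega> k f K ustar"
    and gamma: "\<gamma> > 1 / (2 * C_a)"
    and XY: "ustar \<in> X \<inter> Y" "K \<inter> X \<subseteq> K \<inter> Y" "convex_functions (K \<inter> Y)" "closed_in_H1 \<Omega> (K \<inter> Y)"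
    and r: "r > 0" "\<And>v. v \<in> K \<inter> Y \<Longrightarrow> L2_norm (lebesgue_on \<Omega>) v \<le> r"
    and weights: "wb1 \<ge> 0" "wo1 \<ge> 0" "wb2 \<ge> 0" "wo2 \<ge> 0"
    and points: "N \<ge> 1" "\<And>i. i \<in> {1..N} \<Longrightarrow> x i \<in> \<Omega>"
                "Nb \<ge> 1" "\<And>i. i \<in> {1..Nb} \<Longrightarrow> xb i \<in> frontier \<Omega>"
    and networks: "Xs \<noteq> {}" "Xs \<subseteq> C1_closure \<Omega>" "Xt \<noteq> {}" "Xt \<subseteq> C1_closure \<Omega>"
    and MB_pos: "Ms > 0" "Bs > 0" "Mt > 0" "Bt > 0"
    and Xs_bounds: "\<And>u. u \<in> Xs \<Longrightarrow> H1_norm \<Omega> u \<le> Ms"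
                   "\<And>u. u \<in> Xs \<Longrightarrow> L2_norm (surface_measure \<Omega>) (tr u) \<le> Bs"
    and Xt_bounds: "\<And>v. v \<in> Xt \<Longrightarrow> H1_norm \<Omega> v \<le> Mt"
                   "\<And>v. v \<in> Xt \<Longrightarrow> L2_norm (surface_measure \<Omega>) (tr v) \<le> Bt"
    and Lg: "Lg = L_gamma \<Omega> k f \<gamma>"
    and R1: "R1 = R_pen \<Omega> tr \<psi> h wb1 wo1"
    and R2: "R2 = R_pen \<Omega> tr \<psi> h wb2 wo2"
    and G: "G = G_gamma \<Omega> k f \<gamma> (K \<inter> Y)"
    and H: "H = (\<lambda>u. SUP v\<in>Xt. ereal (Lg u v + R1 u - R2 v))"
    and dLg: "dLg = dL_gamma \<Omega> k f \<gamma> N x"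
    and dR1: "dR1 = dR_pen \<Omega> \<psi> h N x Nb xb wb1 wo1"
    and dR2: "dR2 = dR_pen \<Omega> \<psi> h N x Nb xb wb2 wo2"
    and dG: "dG = (\<lambda>u. SUP v\<in>Xt. ereal (dLg u v + dR1 u - dR2 v))"
    and u_hat: "u_hat \<in> Xs" "\<And>u. u \<in> Xs \<Longrightarrow> dG u_hat \<le> dG u"
    and u_A: "u_A \<in> Xs"
    and C1: "C1 = dual_norm \<Omega> (resid \<Omega> k f ustar)"
    and K1: "K1 = C_b * Ms + dual_norm \<Omega> (src \<Omega> f) + 1 / \<gamma> * (Ms + Mt)"
    and K2: "K2 = wo2 * (r + Mt + 2 * L2_norm (lebesgue_on \<Omega>) \<psi>)"
    and K3: "K3 = 2 * wb2 * (L2_norm (surface_measure \<Omega>) h + Bt)"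
    and K4: "K4 = C_b * (Ms + Mt) + C1 + 1 / \<gamma> * (H1_norm \<Omega> ustar + Mt)"
    and K5: "K5 = wo1 * (Ms + H1_norm \<Omega> ustar + 2 * L2_norm (lebesgue_on \<Omega>) \<psi>)"
    and K6: "K6 = 2 * wb1 * (L2_norm (surface_measure \<Omega>) h + Bs)"
  shows "ereal ((C_a - 1 / (2 * \<gamma>)) * (H1_norm \<Omega> (u_A - ustar))\<^sup>2)
    \<le> (SUP v\<in>K \<inter> Y. INF w\<in>Xt. ereal (K1 * H1_norm \<Omega> (w - v)
            + K2 * L2_norm (lebesgue_on \<Omega>) (w - v)
            + K3 * L2_norm (surface_measure \<Omega>) (tr (w - v))))
      + (INF u\<in>Xs. ereal (K4 * H1_norm \<Omega> (u - ustar)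
            + K5 * L2_norm (lebesgue_on \<Omega>) (u - ustar)
            + K6 * L2_norm (surface_measure \<Omega>) (tr (u - ustar))))
      + 2 * (SUP u\<in>Xs. SUP v\<in>Xt.
            ereal \<bar>Lg u v + R1 u - R2 v - (dLg u v + dR1 u - dR2 v)\<bar>)
      + (dG u_A - dG u_hat)
      + (H ustar - G ustar + ereal (resid \<Omega> k f ustar (ustar - u_A)) - ereal (R1 u_A))"
proof -
  have \<Omega>: "open \<Omega>" "bounded \<Omega>" using domain by (simp_all add: lipschitz_domain_def)
  let ?n = "H1_norm \<Omega>"
  let ?n2 = "L2_norm (lebesgue_on \<Omega>)"
  let ?nb = "L2_norm (surface_measure \<Omega>)"
  interpret A: semi_inner "H1 \<Omega>" "opA \<Omega> k" by (rule semi_inner_H1[OF \<Omega> k])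
  interpret I: semi_inner "H1 \<Omega>" "opA \<Omega> 1" by (rule semi_inner_H1[OF \<Omega>]) simp
  note nrm = H1_norm_eq_nrm[OF \<Omega>]
  have n_nonneg: "0 \<le> ?n w" if "w \<in> H1 \<Omega>" for w using I.nrm_nonneg[OF that] by (simp add: nrm)
  have n_diff: "?n (v - w) \<le> ?n v + ?n w" if "v \<in> H1 \<Omega>" "w \<in> H1 \<Omega>" for v w
    using I.nrm_diff_le[OF that] by (simp only: nrm)
  have n_commute: "?n (v - w) = ?n (w - v)" if "v \<in> H1 \<Omega>" "w \<in> H1 \<Omega>" for v w
    using I.nrm_minus_commute[OF that] by (simp only: nrm)
  note square_diff_le = I.nrm_square_diff_le[folded nrm]
  have n2_nonneg: "0 \<le> ?n2 w" if "w \<in> H1 \<Omega>" for w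
    using L2_norm_nonneg[OF H1_D(1)[OF that]] .
  have nb_nonneg: "0 \<le> ?nb (tr w)" if "w \<in> H1 \<Omega>" for w
    using that trace by (intro L2_norm_nonneg) (auto simp: trace_operator_def)
  have nb_h: "0 \<le> ?nb h" using h by (intro L2_norm_nonneg) (simp add: H_half_def)

  have \<gamma>: "\<gamma> > 0" using gamma CaCb(2) by (meson divide_pos_pos less_trans mult_pos_pos zero_less_numeral zero_less_one)
  have us_K: "ustar \<in> K" and VI: "\<And>v. v \<in> K \<Longrightarrow> resid \<Omega> k f ustar (ustar - v) \<le> 0"
    using ustar by (auto simp: solves_VI_def)
  have us_KY: "ustar \<in> K \<inter> Y" using us_K XY(1) by simp
  have K_H1: "v \<in> H1 \<Omega>" if "v \<in> K" for v using that by (simp add: K obstacle_set_def)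
  have us: "ustar \<in> H1 \<Omega>" by (rule K_H1[OF us_K])
  have Xs_H1: "u \<in> H1 \<Omega>" if "u \<in> Xs" for u using that networks(2) C1_closure_subset_H1[OF \<Omega>] by blast
  have Xt_H1: "v \<in> H1 \<Omega>" if "v \<in> Xt" for v using that networks(4) C1_closure_subset_H1[OF \<Omega>] by blast
  have R1_nonneg: "0 \<le> R1 u" and R2_nonneg: "0 \<le> R2 u" for u
    unfolding R1 R2 by (intro R_pen_nonneg weights)+
  have dR2_nonneg: "0 \<le> dR2 u" for u unfolding dR2 by (intro dR_pen_nonneg weights)
  have R1_us: "R1 ustar = 0" unfolding R1 using us_K by (intro R_pen_eq_0) (simp add: K)
  note resid_us = resid_dual_bound[OF \<Omega> k f(1) us, folded C1]
  have src_dual: "\<bar>src \<Omega> f w\<bar> \<le> dual_norm \<Omega> (src \<Omega> f) * ?n w" "0 \<le> dual_norm \<Omega> (src \<Omega> f)"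
    if "w \<in> H1 \<Omega>" for w
    using dual_norm_bound[of \<Omega> "src \<Omega> f", OF \<Omega> src_scale src_bounded[OF f(1)] that] by blast+
  \<comment> \<open>This is \<open>A_lipschitz\<close> for the pair of \<open>u\<close> and the zero
    function.\<close>
  have opA_dual: "\<bar>opA \<Omega> k u w\<bar> \<le> C_b * ?n u * ?n w" if uw: "u \<in> H1 \<Omega>" "w \<in> H1 \<Omega>" for u w
  proof -
    have "u - (\<lambda>_. 0) = u" by (simp add: fun_eq_iff)
    with opA_diff_bound[OF \<Omega> k uw(1) I.zero_mem[OF uw(1)] uw(2) A_lipschitz[OF uw(1) I.zero_mem[OF uw(1)]]]
    show ?thesis by simp
  qed

  define D1 where "D1 w v = K1 * ?n (w - v) + K2 * ?n2 (w - v) + K3 * ?nb (tr (w - v))" for w v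
  define D2 where "D2 u = K4 * ?n (u - ustar) + K5 * ?n2 (u - ustar) + K6 * ?nb (tr (u - ustar))" for u

  \<comment> \<open>Only the second argument of \<open>Lg\<close> changes. The penalty of
    \<open>v\<close> is zero, so the whole penalty of \<open>w\<close> counts as error.\<close>
  have test_error: "Lg u v - Lg u w + R2 w \<le> D1 w v"
    if u: "u \<in> Xs" and v: "v \<in> K \<inter> Y" and w: "w \<in> Xt" for u v w
  proof -
    note uH = Xs_H1[OF u] and wH = Xt_H1[OF w]
    have vH: "v \<in> H1 \<Omega>" and vK: "v \<in> obstacle_set \<Omega> tr \<psi> h" using v K_H1 K by auto
    note wv = I.diff_mem[OF wH vH]
    have "resid \<Omega> k f u (u - v) - resid \<Omega> k f u (u - w) = resid \<Omega> k f u (w - v)"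
      using uH vH wH by (simp add: resid_diff[OF \<Omega> k f(1)])
    also have "\<dots> \<le> \<bar>opA \<Omega> k u (w - v)\<bar> + \<bar>src \<Omega> f (w - v)\<bar>" by (simp add: resid_def)
    also have "\<dots> \<le> C_b * Ms * ?n (w - v) + dual_norm \<Omega> (src \<Omega> f) * ?n (w - v)"
      using Xs_bounds(1)[OF u] CaCb(1)
      by (intro add_mono src_dual[OF wv] order_trans[OF opA_dual[OF uH wv]] mult_right_mono n_nonneg[OF wv]) auto
    finally have 1: "resid \<Omega> k f u (u - v) - resid \<Omega> k f u (u - w)
      \<le> C_b * Ms * ?n (w - v) + dual_norm \<Omega> (src \<Omega> f) * ?n (w - v)" .
    \<comment> \<open>Both \<open>u\<close> and \<open>w\<close> are networks, so their distance is
      bounded, while that of \<open>u\<close> and \<open>v\<close> is not;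
      \<open>square_diff_le\<close> needs only the former. This gives the last term of
      \<open>K1\<close>.\<close>
    have "?n (u - w) \<le> Ms + Mt"
      using n_diff[OF uH wH] Xs_bounds(1)[OF u] Xt_bounds(1)[OF w] by linarith
    from square_diff_le[OF uH vH wH this]
    have "1 / (2 * \<gamma>) * ((?n (u - w))\<^sup>2 - (?n (u - v))\<^sup>2) \<le> 1 / (2 * \<gamma>) * (2 * (Ms + Mt) * ?n (w - v))"
      using \<gamma> by (intro mult_left_mono) auto
    then have 2: "1 / (2 * \<gamma>) * (?n (u - w))\<^sup>2 - 1 / (2 * \<gamma>) * (?n (u - v))\<^sup>2 \<le> 1 / \<gamma> * (Ms + Mt) * ?n (w - v)"
      by (simp add: right_diff_distrib mult.assoc del: distrib_left_numeral)
    have co: "?n2 w + ?n2 \<psi> \<le> r + Mt + 2 * ?n2 \<psi>"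
      using L2_norm_le_H1_norm[OF wH] Xt_bounds(1)[OF w] n2_nonneg[OF psi(1)] r(1) by linarith
    have cb: "?nb (tr w) + ?nb h \<le> 2 * (?nb h + Bt)"
      using Xt_bounds(2)[OF w] nb_h MB_pos unfolding distrib_left by linarith
    have 3: "R2 w \<le> wo2 * (r + Mt + 2 * ?n2 \<psi>) * ?n2 (w - v) + wb2 * (2 * (?nb h + Bt)) * ?nb (tr (w - v))"
      unfolding R2 by (rule R_pen_bound[OF trace psi(1) h(1) vK wH wv weights(3,4) co cb])
    show ?thesis
      using 1 2 3 unfolding Lg L_gamma_def D1_def K1 K2 K3 by (simp add: algebra_simps)
  qed

  have solution_error: "Lg u v - Lg ustar v + R1 u \<le> D2 u" if u: "u \<in> Xs" and v: "v \<in> Xt" for u v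
  proof -
    note uH = Xs_H1[OF u] and vH = Xt_H1[OF v]
    have usK: "ustar \<in> obstacle_set \<Omega> tr \<psi> h" using us_K K by simp
    note uus = I.diff_mem[OF uH us] and uv = I.diff_mem[OF uH vH]
    \<comment> \<open>Inserting the residual at \<open>ustar\<close> in direction
      \<open>u - v\<close> separates the change of the operator argument, controlled by
      \<open>C_b\<close> and the network bounds, from the change of direction, controlled by the
      dual norm \<open>C1\<close>.\<close>
    have "resid \<Omega> k f u (u - v) - resid \<Omega> k f ustar (ustar - v)
        = (resid \<Omega> k f u (u - v) - resid \<Omega> k f ustar (u - v)) + resid \<Omega> k f ustar (u - ustar)"
      using uH vH us by (simp add: resid_diff[OF \<Omega> k f(1)])
    also have "resid \<Omega> k f u (u - v) - resid \<Omega> k f ustar (u - v) = opA \<Omega> k (u - ustar) (u - v)"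
      using A.diff_left[OF uH us uv] by (simp add: resid_def)
    also have "opA \<Omega> k (u - ustar) (u - v) + resid \<Omega> k f ustar (u - ustar)
        \<le> C_b * ?n (u - ustar) * ?n (u - v) + C1 * ?n (u - ustar)"
      using abs_le_D1[OF opA_dual[OF uus uv]] abs_le_D1[OF resid_us(1)[OF uus]] by linarith
    also have "\<dots> \<le> C_b * ?n (u - ustar) * (Ms + Mt) + C1 * ?n (u - ustar)"
      using n_diff[OF uH vH] Xs_bounds(1)[OF u] Xt_bounds(1)[OF v] CaCb(1) n_nonneg[OF uus]
      by (intro add_right_mono mult_left_mono) auto
    finally have 1: "resid \<Omega> k f u (u - v) - resid \<Omega> k f ustar (ustar - v)
      \<le> C_b * ?n (u - ustar) * (Ms + Mt) + C1 * ?n (u - ustar)" .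
    \<comment> \<open>Here \<open>v\<close> is the common point of the two distances, and
      \<open>ustar\<close> is the endpoint whose distance has to be bounded; hence
      \<open>?n ustar + Mt\<close> in \<open>K4\<close>.\<close>
    have "?n (v - ustar) \<le> ?n ustar + Mt"
      using n_diff[OF vH us] Xt_bounds(1)[OF v] by linarith
    from square_diff_le[OF vH uH us this]
    have "1 / (2 * \<gamma>) * ((?n (ustar - v))\<^sup>2 - (?n (u - v))\<^sup>2)
        \<le> 1 / (2 * \<gamma>) * (2 * (?n ustar + Mt) * ?n (u - ustar))"
      using \<gamma> unfolding n_commute[OF vH us] n_commute[OF vH uH] n_commute[OF us uH]
      by (intro mult_left_mono) auto
    then have 2: "1 / (2 * \<gamma>) * (?n (ustar - v))\<^sup>2 - 1 / (2 * \<gamma>) * (?n (u - v))\<^sup>2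
        \<le> 1 / \<gamma> * (?n ustar + Mt) * ?n (u - ustar)"
      by (simp add: right_diff_distrib mult.assoc del: distrib_left_numeral)
    have co: "?n2 u + ?n2 \<psi> \<le> Ms + ?n ustar + 2 * ?n2 \<psi>"
      using L2_norm_le_H1_norm[OF uH] Xs_bounds(1)[OF u] n2_nonneg[OF psi(1)] n_nonneg[OF us] by linarith
    have cb: "?nb (tr u) + ?nb h \<le> 2 * (?nb h + Bs)"
      using Xs_bounds(2)[OF u] nb_h MB_pos unfolding distrib_left by linarith
    have 3: "R1 u \<le> wo1 * (Ms + ?n ustar + 2 * ?n2 \<psi>) * ?n2 (u - ustar)
        + wb1 * (2 * (?nb h + Bs)) * ?nb (tr (u - ustar))"
      unfolding R1 by (rule R_pen_bound[OF trace psi(1) h(1) usK uH uus weights(1,2) co cb])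
    show ?thesis
      using 1 2 3 unfolding Lg L_gamma_def D2_def K4 K5 K6 by (simp add: algebra_simps)
  qed

  have G_us: "G ustar = 0"
  proof -
    have "ustar - ustar = (\<lambda>_. 0)" by (simp add: fun_eq_iff)
    then have "?n (ustar - ustar) = 0" using I.nrm_zero[OF us] by (simp add: nrm)
    moreover have "resid \<Omega> k f ustar (ustar - ustar) = 0" by (simp add: resid_diff[OF \<Omega> k f(1) us us us])
    ultimately have "Lg ustar ustar = 0" by (simp add: Lg L_gamma_def)
    moreover have "Lg ustar v \<le> 0" if "v \<in> K \<inter> Y" for v
    proof -
      have "0 \<le> 1 / (2 * \<gamma>) * (?n (ustar - v))\<^sup>2" using \<gamma> by simp
      with VI[of v] that show ?thesis unfolding Lg L_gamma_def by auto
    qed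
    ultimately show ?thesis
      unfolding G G_gamma_def Lg[symmetric] zero_ereal_def
      by (intro antisym SUP_least SUP_upper2[OF us_KY]) auto
  qed

  \<comment> \<open>Coercivity at \<open>u_A\<close> and \<open>ustar\<close> compares two
    residuals. The one at \<open>u_A\<close> is the leading part of \<open>Lg u_A ustar\<close>,
    whose quadratic term uses up \<open>1 / (2 * \<gamma>)\<close> of \<open>C_a\<close>; the one at
    \<open>ustar\<close> changes sign with its argument.\<close>
  have coercivity: "(C_a - 1 / (2 * \<gamma>)) * (?n (u_A - ustar))\<^sup>2
      \<le> Lg u_A ustar + resid \<Omega> k f ustar (ustar - u_A)"
  proof -
    note uA = Xs_H1[OF u_A]
    have "C_a * (?n (u_A - ustar))\<^sup>2
        \<le> resid \<Omega> k f u_A (u_A - ustar) - resid \<Omega> k f ustar (u_A - ustar)"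
      using A_coercive[OF uA us] by (simp add: resid_def)
    also have "\<dots> = resid \<Omega> k f u_A (u_A - ustar) + resid \<Omega> k f ustar (ustar - u_A)"
      using uA us by (simp add: resid_diff[OF \<Omega> k f(1)])
    finally show ?thesis by (simp add: Lg L_gamma_def left_diff_distrib)
  qed

  \<comment> \<open>For the upper bound the penalty of \<open>ustar\<close> vanishes, the quadratic
    term and \<open>R2\<close> only help, and \<open>C1\<close> bounds the residual because
    \<open>Xt\<close> is bounded in H1.\<close>
  obtain h' where h': "H ustar = ereal h'"
  proof -
    have bnd: "Lg ustar v + R1 ustar - R2 v \<le> C1 * (?n ustar + Mt)" if v: "v \<in> Xt" for v
    proof -
      note vH = Xt_H1[OF v]
      have "0 \<le> 1 / (2 * \<gamma>) * (?n (ustar - v))\<^sup>2" using \<gamma> by simp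
      then have "Lg ustar v \<le> resid \<Omega> k f ustar (ustar - v)" unfolding Lg L_gamma_def by linarith
      also have "\<dots> \<le> C1 * ?n (ustar - v)" using resid_us(1)[OF I.diff_mem[OF us vH]] by linarith
      also have "\<dots> \<le> C1 * (?n ustar + Mt)"
        using n_diff[OF us vH] Xt_bounds(1)[OF v] resid_us(2)[OF us] by (intro mult_left_mono) auto
      finally show ?thesis using R1_us R2_nonneg[of v] by linarith
    qed
    have "\<exists>c. H ustar = ereal c"
      unfolding H by (rule SUP_ereal_real[OF networks(3)]) (rule bnd)
    then show thesis using that by blast
  qed

  have dG_real: "\<exists>c. dG u = ereal c" for u
  proof -
    obtain C where C: "\<And>v. dLg u v \<le> C" unfolding dLg
      using dL_gamma_bounded_above[OF \<gamma>, where \<Omega> = \<Omega> and k = k and f = f and N = N and x = x and u = u] by blast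
    have bnd: "dLg u v + dR1 u - dR2 v \<le> C + dR1 u" for v using C[of v] dR2_nonneg[of v] by linarith
    show ?thesis unfolding dG by (rule SUP_ereal_real[OF networks(3)]) (rule bnd)
  qed
  obtain a b where a: "dG u_A = ereal a" and b: "dG u_hat = ereal b" using dG_real by metis

  let ?S = "SUP v\<in>K \<inter> Y. INF w\<in>Xt. ereal (D1 w v)"
  let ?T = "INF u\<in>Xs. ereal (D2 u)"
  let ?E = "SUP u\<in>Xs. SUP v\<in>Xt. ereal \<bar>Lg u v + R1 u - R2 v - (dLg u v + dR1 u - dR2 v)\<bar>"
  let ?lhs = "(C_a - 1 / (2 * \<gamma>)) * (?n (u_A - ustar))\<^sup>2"
  let ?res = "resid \<Omega> k f ustar (ustar - u_A)"
  have K_nonneg: "0 \<le> K1" "0 \<le> K2" "0 \<le> K3" "0 \<le> K4" "0 \<le> K5" "0 \<le> K6"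
    unfolding K1 K2 K3 K4 K5 K6
    using CaCb MB_pos weights r(1) \<gamma> src_dual(2)[OF us] resid_us(2)[OF us] n_nonneg[OF us]
      n2_nonneg[OF psi(1)] nb_h
    by (auto intro!: add_nonneg_nonneg mult_nonneg_nonneg)
  have D1_nonneg: "0 \<le> D1 w v" if "w \<in> H1 \<Omega>" "v \<in> H1 \<Omega>" for w v
    unfolding D1_def using I.diff_mem[OF that]
    by (intro add_nonneg_nonneg mult_nonneg_nonneg K_nonneg n_nonneg n2_nonneg nb_nonneg)
  have D2_nonneg: "0 \<le> D2 u" if "u \<in> H1 \<Omega>" for u
    unfolding D2_def using I.diff_mem[OF that us]
    by (intro add_nonneg_nonneg mult_nonneg_nonneg K_nonneg n_nonneg n2_nonneg nb_nonneg)
  have S_nonneg: "0 \<le> ?S"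
    by (rule SUP_upper2[OF us_KY], rule INF_greatest) (simp add: D1_nonneg Xt_H1 us)
  have T_nonneg: "0 \<le> ?T" by (rule INF_greatest) (simp add: D2_nonneg Xs_H1)
  have E_upper: "ereal \<bar>Lg u v + R1 u - R2 v - (dLg u v + dR1 u - dR2 v)\<bar> \<le> ?E"
    if "u \<in> Xs" "v \<in> Xt" for u v
    by (rule SUP_upper2[OF that(1)], rule SUP_upper[OF that(2)])
  have E_nonneg: "0 \<le> ?E"
  proof -
    obtain v where "v \<in> Xt" using networks(3) by blast
    from E_upper[OF u_A this] show ?thesis by (rule order_trans[rotated]) simp
  qed

  have "ereal ?lhs \<le> ?S + ?T + 2 * ?E + (dG u_A - dG u_hat) + (H ustar - G ustar + ereal ?res - ereal (R1 u_A))"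
  \<comment> \<open>If one of these suprema is infinite, so is the right-hand side: the other error
    terms are nonnegative and the differences are finite, so opposite infinities never meet.\<close>
  proof (cases "?S = \<infinity> \<or> ?E = \<infinity>")
    case True
    then have inf: "?S + ?T + 2 * ?E = \<infinity>" using S_nonneg T_nonneg E_nonneg by auto
    show ?thesis unfolding inf by (simp add: a b h' G_us)
  next
    case False
    then obtain s e where s: "?S = ereal s" and e: "?E = ereal e"
      using S_nonneg E_nonneg by (cases ?S; cases ?E) auto
    have gap: "\<bar>Lg u v + R1 u - R2 v - (dLg u v + dR1 u - dR2 v)\<bar> \<le> e" if "u \<in> Xs" "v \<in> Xt" for u v
      using E_upper[OF that] unfolding e by simp
    have "?lhs - ?res + R1 u_A - e - a \<le> D1 w ustar" if w: "w \<in> Xt" for w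
    proof -
      have "ereal (dLg u_A w + dR1 u_A - dR2 w) \<le> dG u_A" unfolding dG by (rule SUP_upper[OF w])
      then have "dLg u_A w + dR1 u_A - dR2 w \<le> a" by (simp add: a)
      with gap[OF u_A w] test_error[OF u_A us_KY w] coercivity show ?thesis by linarith
    qed
    then have "ereal (?lhs - ?res + R1 u_A - e - a) \<le> ?S"
      by (intro SUP_upper2[OF us_KY] INF_greatest) simp
    then have 1: "?lhs - ?res + R1 u_A - e - a \<le> s" by (simp add: s)
    \<comment> \<open>Optimality of \<open>u_hat\<close> permits comparison with any network
      \<open>u\<close>. Its discrete supremum exceeds \<open>H ustar\<close> by at most the cost of
      replacing \<open>u\<close> by \<open>ustar\<close> and a second quadrature error.\<close>
    have "b - e - h' \<le> D2 u" if u: "u \<in> Xs" for u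
    proof -
      have "dG u \<le> ereal (e + D2 u + h')"
        unfolding dG
      proof (rule SUP_least)
        fix v assume v: "v \<in> Xt"
        have "ereal (Lg ustar v + R1 ustar - R2 v) \<le> H ustar" unfolding H by (rule SUP_upper[OF v])
        then have "Lg ustar v + R1 ustar - R2 v \<le> h'" by (simp add: h')
        with gap[OF u v] solution_error[OF u v] R1_us
        show "ereal (dLg u v + dR1 u - dR2 v) \<le> ereal (e + D2 u + h')" by simp
      qed
      from order_trans[OF u_hat(2)[OF u] this] show ?thesis by (simp add: b)
    qed
    then have T_lower: "ereal (b - e - h') \<le> ?T" by (intro INF_greatest) simp
    obtain t where t: "?T = ereal t"
    proof -
      have "?T \<le> ereal (D2 u_A)" by (rule INF_lower[OF u_A])
      then show thesis using T_nonneg that by (cases ?T) auto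
    qed
    from T_lower have "b - e - h' \<le> t" by (simp add: t)
    \<comment> \<open>Summing the two bounds yields \<open>e\<close> twice, whence the factor 2, and
      \<open>a - b\<close>, the optimization error.\<close>
    with 1 show ?thesis
      unfolding s t e a b h' G_us by simp
  qed
  then show ?thesis unfolding D1_def D2_def .
qed

end
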